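(* Let $G=(V,E,p,(V_{E},V_{O}))$ be a parity game on which a lifting sequence is applied, such that at some point a vertex $v$ with $p(v)=k$ is the first vertex whose measure value becomes $\top$, and let $\rho$ be the measure at that point. Let $A=\mathrm{Attr}^{\ge k}_{O}(\{v\})$. (a) If $v\in V_{O}$, then for every successor $u$ of $v$ whose $\rho$-value is maximal among $\{\rho(w):w\in\mathrm{post}(v)\}$ there is an Odd-dominion $D_u$ containing $A$ such that $p(w)\ge k$ for all $w\in D_u$. Moreover, Odd has a winning strategy $\sigma$ that is closed on $D_u$, satisfies $\sigma(v)=u$, and on $A\setminus\{v\}$ is the strategy attracting towards $v$. (b) If $v\in V_{E}$, then there is an Odd-dominion $D$ containing $A$ such that $p(w)\ge k$ for all $w\in D$. Moreover, Odd has a winning strategy $\sigma$ that is closed on $D$ and on $A\setminus\{v\}$ is the strategy attracting towards $v$. In this case $\mathrm{post}(v)\subseteq D$.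
   Context: A parity game $G=(V,E,p,(V_{E},V_{O}))$: finite $V$ partitioned into $V_{E}$ (Even) and $V_{O}$ (Odd), total edge relation $E$, priorities $p:V\to\mathbb{N}$; $\mathrm{post}(v)=\{w:(v,w)\in E\}$, $V_i=\{v:p(v)=i\}$, $V_{\ge k}=\{v:p(v)\ge k\}$. Plays are infinite paths; Even wins iff the least priority occurring infinitely often is even. A set $D$ is an Odd-dominion if Odd has a strategy such that every play starting in $D$ consistent with it is won by Odd and stays in $D$; a strategy is closed on $D$ if all consistent plays from $D$ stay in $D$. Let $d$ be one more than the largest priority. $\mathbb{M}$ consists of $\top$ and all tuples $(m_0,\dots,m_{d-1})\in\mathbb{N}^d$ with $m_i=0$ for even $i$ and $m_i\le|V_i|$ for odd $i$, ordered lexicographically with $\top$ maximal; $m<_i m'$ compares positions $0..i$ only (tuples $<_i\top$, $\top=_i\top$). $\mathrm{Prog}(\rho,v,w)$, for $w\in\mathrm{post}(v)$, is the least $m\in\mathbb{M}$ with $m\ge_{p(v)}\rho(w)$ if $p(v)$ is even, and with $m>_{p(v)}\rho(w)$ or $m=\rho(w)=\top$ if $p(v)$ is odd. $\mathrm{Lift}(\rho,v)$ replaces $\rho(v)$ by $\max\{\rho(v),\min_{w\in\mathrm{post}(v)}\mathrm{Prog}(\rho,v,w)\}$ if $v\in V_{E}$, and by $\max\{\rho(v),\max_{w\in\mathrm{post}(v)}\mathrm{Prog}(\rho,v,w)\}$ if $v\in V_{O}$. A lifting sequence is $\rho_0,\rho_1,\dots$ with $\rho_0\equiv(0,\dots,0)$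 and $\rho_{j+1}=\mathrm{Lift}(\rho_j,v_j)\neq\rho_j$ for some vertex $v_j$. Guarded attractor: for $U\subseteq V_{\ge k}$, $\mathrm{Attr}^{\ge k}_{O}(U)$ is the least $A$ with $U\subseteq A\subseteq V_{\ge k}$ such that every $u\in V_{O}\cap V_{\ge k}$ with $\mathrm{post}(u)\cap A\ne\emptyset$ is in $A$ and every $u\in V_{E}\cap V_{\ge k}$ with $\mathrm{post}(u)\subseteq A$ is in $A$. Computing $A$ as the limit of $A_0=U$, $A_{j+1}=A_j\cup\{$vertices added by the rules from $A_j\}$, the strategy attracting towards $U$ maps each $u\in(A\setminus U)\cap V_{O}$ first added in $A_{j+1}$ to a successor in $A_j$. *)

theory Defs
  imports Main
begin

definition post :: "('v \<times> 'v) set \<Rightarrow> 'v \<Rightarrow> 'v set" where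
  "post E v = {w. (v, w) \<in> E}"

definition parity_game ::
  "'v set \<Rightarrow> ('v \<times> 'v) set \<Rightarrow> ('v \<Rightarrow> nat) \<Rightarrow> 'v set \<Rightarrow> 'v set \<Rightarrow> bool" where
  "parity_game V E p VE VO \<longleftrightarrow>
     finite V \<and> E \<subseteq> V \<times> V \<and> (\<forall>v\<in>V. post E v \<noteq> {}) \<and>
     VE \<inter> VO = {} \<and> VE \<union> VO = V"

definition is_play :: "('v \<times> 'v) set \<Rightarrow> (nat \<Rightarrow> 'v) \<Rightarrow> bool" where
  "is_play E \<pi> \<longleftrightarrow> (\<forall>i. (\<pi> i, \<pi> (Suc i)) \<in> E)"

definition odd_wins :: "('v \<Rightarrow> nat) \<Rightarrow> (nat \<Rightarrow> 'v) \<Rightarrow> bool" where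
  "odd_wins p \<pi> \<longleftrightarrow> odd (LEAST q. \<exists>\<^sub>\<infinity>i. p (\<pi> i) = q)"

definition odd_strategy :: "('v \<times> 'v) set \<Rightarrow> 'v set \<Rightarrow> ('v \<Rightarrow> 'v) \<Rightarrow> bool" where
  "odd_strategy E VO \<sigma> \<longleftrightarrow> (\<forall>v\<in>VO. (v, \<sigma> v) \<in> E)"

definition consistent :: "'v set \<Rightarrow> ('v \<Rightarrow> 'v) \<Rightarrow> (nat \<Rightarrow> 'v) \<Rightarrow> bool" where
  "consistent VO \<sigma> \<pi> \<longleftrightarrow> (\<forall>i. \<pi> i \<in> VO \<longrightarrow> \<pi> (Suc i) = \<sigma> (\<pi> i))"

definition strategy_closed ::
  "('v \<times> 'v) set \<Rightarrow> 'v set \<Rightarrow> ('v \<Rightarrow> 'v) \<Rightarrow> 'v set \<Rightarrow> bool" where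
  "strategy_closed E VO \<sigma> D \<longleftrightarrow>
     (\<forall>\<pi>. is_play E \<pi> \<and> consistent VO \<sigma> \<pi> \<and> \<pi> 0 \<in> D \<longrightarrow> (\<forall>i. \<pi> i \<in> D))"

definition strategy_wins ::
  "('v \<times> 'v) set \<Rightarrow> ('v \<Rightarrow> nat) \<Rightarrow> 'v set \<Rightarrow> ('v \<Rightarrow> 'v) \<Rightarrow> 'v set \<Rightarrow> bool" where
  "strategy_wins E p VO \<sigma> D \<longleftrightarrow>
     (\<forall>\<pi>. is_play E \<pi> \<and> consistent VO \<sigma> \<pi> \<and> \<pi> 0 \<in> D \<longrightarrow> odd_wins p \<pi>)"

definition odd_dominion ::
  "'v set \<Rightarrow> ('v \<times> 'v) set \<Rightarrow> ('v \<Rightarrow> nat) \<Rightarrow> 'v set \<Rightarrow> 'v set \<Rightarrow> bool" where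
  "odd_dominion V E p VO D \<longleftrightarrow> D \<subseteq> V \<and>
     (\<exists>\<sigma>. odd_strategy E VO \<sigma> \<and> strategy_wins E p VO \<sigma> D \<and> strategy_closed E VO \<sigma> D)"

inductive_set odd_attr ::
  "'v set \<Rightarrow> ('v \<times> 'v) set \<Rightarrow> ('v \<Rightarrow> nat) \<Rightarrow> 'v set \<Rightarrow> 'v set \<Rightarrow> nat \<Rightarrow> 'v set \<Rightarrow> 'v set"
  for V E p VE VO k U where
  base: "u \<in> U \<Longrightarrow> u \<in> odd_attr V E p VE VO k U"
| odd_step: "u \<in> VO \<Longrightarrow> u \<in> V \<Longrightarrow> p u \<ge> k \<Longrightarrow> w \<in> post E u \<Longrightarrow>
     w \<in> odd_attr V E p VE VO k U \<Longrightarrow> u \<in> odd_attr V E p VE VO k U"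
| even_step: "u \<in> VE \<Longrightarrow> u \<in> V \<Longrightarrow> p u \<ge> k \<Longrightarrow>
     (\<And>w. w \<in> post E u \<Longrightarrow> w \<in> odd_attr V E p VE VO k U) \<Longrightarrow> u \<in> odd_attr V E p VE VO k U"

fun attr_stage ::
  "'v set \<Rightarrow> ('v \<times> 'v) set \<Rightarrow> ('v \<Rightarrow> nat) \<Rightarrow> 'v set \<Rightarrow> 'v set \<Rightarrow> nat \<Rightarrow> 'v set \<Rightarrow> nat \<Rightarrow> 'v set" where
  "attr_stage V E p VE VO k U 0 = U"
| "attr_stage V E p VE VO k U (Suc j) =
     attr_stage V E p VE VO k U j \<union>
     {u \<in> V. p u \<ge> k \<and>
        ((u \<in> VO \<and> post E u \<inter> attr_stage V E p VE VO k U j \<noteq> {}) \<or>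
         (u \<in> VE \<and> post E u \<subseteq> attr_stage V E p VE VO k U j))}"

definition attracting_strategy ::
  "'v set \<Rightarrow> ('v \<times> 'v) set \<Rightarrow> ('v \<Rightarrow> nat) \<Rightarrow> 'v set \<Rightarrow> 'v set \<Rightarrow> nat \<Rightarrow> 'v set \<Rightarrow> ('v \<Rightarrow> 'v) \<Rightarrow> bool" where
  "attracting_strategy V E p VE VO k U \<tau> \<longleftrightarrow>
     (\<forall>j u. u \<in> VO \<and> u \<notin> U \<and> u \<in> attr_stage V E p VE VO k U (Suc j) \<and>
            u \<notin> attr_stage V E p VE VO k U j \<longrightarrow>
            \<tau> u \<in> post E u \<and> \<tau> u \<in> attr_stage V E p VE VO k U j)"

datatype meas = Top | Tup "nat list"

definition num_prios :: "'v set \<Rightarrow> ('v \<Rightarrow> nat) \<Rightarrow> nat" where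
  "num_prios V p = Suc (Max (p ` V))"

definition meas_dom :: "'v set \<Rightarrow> ('v \<Rightarrow> nat) \<Rightarrow> meas set" where
  "meas_dom V p = insert Top
     {Tup m | m. length m = num_prios V p \<and>
        (\<forall>i < num_prios V p. even i \<longrightarrow> m ! i = 0) \<and>
        (\<forall>i < num_prios V p. odd i \<longrightarrow> m ! i \<le> card {v \<in> V. p v = i})}"

fun meas_le :: "meas \<Rightarrow> meas \<Rightarrow> bool" where
  "meas_le _ Top = True"
| "meas_le Top (Tup _) = False"
| "meas_le (Tup a) (Tup b) = (a = b \<or> (a, b) \<in> lexord {(x, y). (x::nat) < y})"

definition meas_lt :: "meas \<Rightarrow> meas \<Rightarrow> bool" where
  "meas_lt a b \<longleftrightarrow> meas_le a b \<and> a \<noteq> b"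

fun trunc :: "nat \<Rightarrow> meas \<Rightarrow> meas" where
  "trunc i Top = Top"
| "trunc i (Tup m) = Tup (take (Suc i) m)"

definition meas_le_k :: "nat \<Rightarrow> meas \<Rightarrow> meas \<Rightarrow> bool" where
  "meas_le_k i a b \<longleftrightarrow> meas_le (trunc i a) (trunc i b)"

definition meas_lt_k :: "nat \<Rightarrow> meas \<Rightarrow> meas \<Rightarrow> bool" where
  "meas_lt_k i a b \<longleftrightarrow> meas_lt (trunc i a) (trunc i b)"

definition meas_least :: "meas set \<Rightarrow> meas" where
  "meas_least S = (THE m. m \<in> S \<and> (\<forall>m'\<in>S. meas_le m m'))"

definition meas_greatest :: "meas set \<Rightarrow> meas" where
  "meas_greatest S = (THE m. m \<in> S \<and> (\<forall>m'\<in>S. meas_le m' m))"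

definition Prog ::
  "'v set \<Rightarrow> ('v \<Rightarrow> nat) \<Rightarrow> ('v \<Rightarrow> meas) \<Rightarrow> 'v \<Rightarrow> 'v \<Rightarrow> meas" where
  "Prog V p \<rho> v w =
     (if even (p v)
      then meas_least {m \<in> meas_dom V p. meas_le_k (p v) (\<rho> w) m}
      else meas_least {m \<in> meas_dom V p. meas_lt_k (p v) (\<rho> w) m \<or> (m = Top \<and> \<rho> w = Top)})"

definition Lift ::
  "'v set \<Rightarrow> ('v \<times> 'v) set \<Rightarrow> ('v \<Rightarrow> nat) \<Rightarrow> 'v set \<Rightarrow> 'v set \<Rightarrow> ('v \<Rightarrow> meas) \<Rightarrow> 'v \<Rightarrow> ('v \<Rightarrow> meas)" where
  "Lift V E p VE VO \<rho> v =
     (if v \<in> VE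
      then \<rho>(v := meas_greatest {\<rho> v, meas_least (Prog V p \<rho> v ` post E v)})
      else \<rho>(v := meas_greatest {\<rho> v, meas_greatest (Prog V p \<rho> v ` post E v)}))"

definition lifting_sequence ::
  "'v set \<Rightarrow> ('v \<times> 'v) set \<Rightarrow> ('v \<Rightarrow> nat) \<Rightarrow> 'v set \<Rightarrow> 'v set \<Rightarrow>
   (nat \<Rightarrow> 'v \<Rightarrow> meas) \<Rightarrow> (nat \<Rightarrow> 'v) \<Rightarrow> nat \<Rightarrow> bool" where
  "lifting_sequence V E p VE VO \<rho>s vs n \<longleftrightarrow>
     \<rho>s 0 = (\<lambda>_. Tup (replicate (num_prios V p) 0)) \<and>
     (\<forall>j < n. vs j \<in> V \<and> \<rho>s (Suc j) = Lift V E p VE VO (\<rho>s j) (vs j) \<and> \<rho>s (Suc j) \<noteq> \<rho>s j)"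

end

theory Submission
  imports Defs
begin

text \<open>Let \<open>k = p v\<close>; a vertex can only be the first to reach \<open>Top\<close> if \<open>k\<close> is odd. Take the part of the
  game with priorities at least \<open>k\<close> outside the attractor \<open>A\<close>, where Even wins on escaping to a smaller
  priority and Odd wins on reaching \<open>A\<close>. Its winning regions are \<open>W\<close> for Even, with a progress measure,
  and \<open>D'\<close> for Odd, with a positional strategy. As \<open>v\<close> is not in \<open>W\<close>, the entry at \<open>k\<close> of the progress
  measure never reaches \<open>|V\<^sub>k|\<close> on \<open>W\<close>, and it bounds the lifted measures there as long as none is \<open>Top\<close>.
  A successor that pushes \<open>v\<close> to \<open>Top\<close> has all odd entries up to \<open>k\<close> maximal, so it lies in
  \<open>D = A \<union> D'\<close>. Playing the positional strategy on \<open>D'\<close> and the attracting one on \<open>A\<close>, a play either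
  visits \<open>v\<close> infinitely often and never sees a priority below \<open>k\<close>, or ends up in \<open>D'\<close>.\<close>

subsection \<open>Lexicographic order and progress\<close>

text \<open>Measures are treated as functions on positions, so that \<open><_i\<close> becomes
  \<open>lex_lt (Suc i)\<close> without truncating anything and measures can be added pointwise. The
  non-strict order is written \<open>\<not> lex_lt q g f\<close>.\<close>

definition lex_lt :: "nat \<Rightarrow> (nat \<Rightarrow> nat) \<Rightarrow> (nat \<Rightarrow> nat) \<Rightarrow> bool" where
  "lex_lt q f g \<longleftrightarrow> (\<exists>i<q. f i < g i \<and> (\<forall>j<i. f j = g j))"

lemma lex_lt_asym: "lex_lt q f g \<Longrightarrow> \<not> lex_lt q g f"
  unfolding lex_lt_def by (metis linorder_cases order.asym order_less_irrefl)

lemma lex_lt_linear: "lex_lt q f g \<or> (\<forall>i<q. f i = g i) \<or> lex_lt q g f"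
proof (cases "\<forall>i<q. f i = g i")
  case False
  define i where "i = (LEAST i. i < q \<and> f i \<noteq> g i)"
  have i: "i < q" "f i \<noteq> g i"
    using LeastI_ex[of "\<lambda>i. i < q \<and> f i \<noteq> g i"] False unfolding i_def by auto
  have "\<forall>j<i. f j = g j"
    using not_less_Least[of _ "\<lambda>i. i < q \<and> f i \<noteq> g i"] i(1) unfolding i_def[symmetric]
    by (meson less_trans)
  with i show ?thesis
    unfolding lex_lt_def by (metis nat_neq_iff)
qed simp

lemma lex_lt_trans:
  assumes "lex_lt q f g" "lex_lt q g h"
  shows "lex_lt q f h"
proof -
  obtain i j where i: "i < q" "f i < g i" "\<forall>l<i. f l = g l"
    and j: "j < q" "g j < h j" "\<forall>l<j. g l = h l"
    using assms unfolding lex_lt_def by blast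
  then have "min i j < q \<and> f (min i j) < h (min i j) \<and> (\<forall>l<min i j. f l = h l)"
    by (cases i j rule: linorder_cases) auto
  then show ?thesis unfolding lex_lt_def by blast
qed

lemma lex_lt_cong:
  assumes "\<forall>i<q. f i = f' i" "\<forall>i<q. g i = g' i"
  shows "lex_lt q f g = lex_lt q f' g'"
proof -
  have "f i < g i \<and> (\<forall>j<i. f j = g j) \<longleftrightarrow> f' i < g' i \<and> (\<forall>j<i. f' j = g' j)" if "i < q" for i
    using assms that by auto
  then show ?thesis unfolding lex_lt_def by blast
qed

lemma lex_le_lt_trans: "\<not> lex_lt q g f \<Longrightarrow> lex_lt q g h \<Longrightarrow> lex_lt q f h"
  using lex_lt_linear[of q f g] lex_lt_trans lex_lt_cong[of q f g h h] by blast

lemma lex_lt_le_trans: "lex_lt q f g \<Longrightarrow> \<not> lex_lt q h g \<Longrightarrow> lex_lt q f h"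
  using lex_lt_linear[of q g h] lex_lt_trans lex_lt_cong[of q f f h g] by metis

lemma lex_le_trans: "\<not> lex_lt q g f \<Longrightarrow> \<not> lex_lt q h g \<Longrightarrow> \<not> lex_lt q h f"
  using lex_lt_le_trans by blast

lemma lex_le_pointwise: "(\<And>i. i < q \<Longrightarrow> f i \<le> g i) \<Longrightarrow> \<not> lex_lt q g f"
  unfolding lex_lt_def by (metis not_less)

lemma lex_lt_add: "lex_lt q (\<lambda>i. f i + c i) (\<lambda>i. g i + c i) = lex_lt q f g"
  unfolding lex_lt_def by simp

lemma lex_lt_mono: "lex_lt q f g \<Longrightarrow> q \<le> q' \<Longrightarrow> lex_lt q' f g"
  unfolding lex_lt_def by (meson order.strict_trans2)

text \<open>Here \<open>f\<close> and \<open>g\<close> are the measures at the source and the target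
  of an edge, and \<open>q\<close> is the priority of the source. This is the condition behind
  \<open>Prog\<close>, without the cases of \<open>Top\<close>.\<close>

definition progress :: "nat \<Rightarrow> (nat \<Rightarrow> nat) \<Rightarrow> (nat \<Rightarrow> nat) \<Rightarrow> bool" where
  "progress q f g \<longleftrightarrow> (if odd q then lex_lt (Suc q) g f else \<not> lex_lt (Suc q) f g)"

lemma progress_add: "progress q f g \<Longrightarrow> progress q (\<lambda>i. f i + c i) (\<lambda>i. g i + c i)"
  unfolding progress_def lex_lt_add .

lemma progress_le_trans: "progress q f g \<Longrightarrow> \<not> lex_lt (Suc q) g h \<Longrightarrow> progress q f h"
  using lex_le_lt_trans[of "Suc q" g h f] lex_le_trans[of "Suc q" g h f]
  by (simp add: progress_def split: if_splits)

text \<open>Adding \<open>c\<close> turns progress towards 0 into progress towards \<open>c\<close>,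
  hence towards anything pointwise below \<open>c\<close>. It treats edges from one certified region
  into another one stacked below it.\<close>

lemma progress_add_pointwise:
  assumes "progress q f (\<lambda>_. 0)" "\<And>i. g i \<le> c i"
  shows "progress q (\<lambda>i. f i + c i) g"
  using progress_le_trans[OF progress_add[OF assms(1), of c], of g] assms(2)
    lex_le_pointwise[of "Suc q" g c] by simp

subsection \<open>Positional determinacy with progress measures\<close>

lemma odd_wins_shift: "odd_wins p (\<lambda>i. \<pi> (i + n)) = odd_wins p \<pi>"
proof -
  have "(\<exists>\<^sub>\<infinity>i. p (\<pi> (i + n)) = q) = (\<exists>\<^sub>\<infinity>i. p (\<pi> i) = q)" for q
    unfolding frequently_def cofinite_eq_sequentially
    by (subst eventually_sequentially_seg[symmetric, of _ n]) simp
  then show ?thesis by (simp add: odd_wins_def)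
qed

lemma odd_wins_least:
  assumes "\<And>i. d \<le> p (\<pi> i)" "\<exists>\<^sub>\<infinity>i. p (\<pi> i) = d" "odd d"
  shows "odd_wins p \<pi>"
proof -
  have "(LEAST q. \<exists>\<^sub>\<infinity>i. p (\<pi> i) = q) = d"
  proof (rule Least_equality)
    fix y assume "\<exists>\<^sub>\<infinity>i. p (\<pi> i) = y"
    then show "d \<le> y" using assms(1) by (auto dest: frequently_ex)
  qed (fact assms(2))
  then show ?thesis using assms(3) by (simp add: odd_wins_def)
qed

lemma is_play_shift: "is_play E \<pi> \<Longrightarrow> is_play E (\<lambda>i. \<pi> (i + n))"
  by (simp add: is_play_def)

lemma consistent_shift: "consistent VO \<sigma> \<pi> \<Longrightarrow> consistent VO \<sigma> (\<lambda>i. \<pi> (i + n))"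
  by (simp add: consistent_def)

lemma consistent_cong:
  "consistent VO \<sigma> \<pi> \<Longrightarrow> (\<And>i. \<pi> i \<in> VO \<Longrightarrow> \<sigma> (\<pi> i) = \<sigma>' (\<pi> i)) \<Longrightarrow> consistent VO \<sigma>' \<pi>"
  by (simp add: consistent_def)

text \<open>A progress measure on \<open>W\<close> for the game in which Even also wins on reaching \<open>T\<close>; reaching
  \<open>T\<close> counts as reaching the measure \<open>0\<close>.\<close>

definition even_cert ::
  "('v \<times> 'v) set \<Rightarrow> ('v \<Rightarrow> nat) \<Rightarrow> 'v set \<Rightarrow> 'v set \<Rightarrow> 'v set \<Rightarrow> ('v \<Rightarrow> nat \<Rightarrow> nat) \<Rightarrow> bool" where
  "even_cert E p VO W T r \<longleftrightarrow>
     (\<forall>x\<in>W. \<forall>i. r x i \<le> (if odd i then card {y\<in>W. p y = i} else 0)) \<and>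
     (\<forall>x\<in>W.
       let ok = \<lambda>y. y \<in> T \<and> progress (p x) (r x) (\<lambda>_. 0) \<or> y \<in> W \<and> progress (p x) (r x) (r y)
       in if x \<in> VO then \<forall>y\<in>post E x. ok y else \<exists>y\<in>post E x. ok y)"

text \<open>\<open>\<sigma>\<close> is winning on \<open>D\<close> in the game on the vertices \<open>S\<close> in which Odd wins on leaving \<open>S\<close>.\<close>

definition odd_cert ::
  "('v \<times> 'v) set \<Rightarrow> ('v \<Rightarrow> nat) \<Rightarrow> 'v set \<Rightarrow> 'v set \<Rightarrow> 'v set \<Rightarrow> ('v \<Rightarrow> 'v) \<Rightarrow> bool" where
  "odd_cert E p VO D S \<sigma> \<longleftrightarrow>
     (\<forall>x\<in>D. if x \<in> VO then \<sigma> x \<in> post E x \<and> (\<sigma> x \<in> D \<or> \<sigma> x \<notin> S) else post E x \<inter> S \<subseteq> D) \<and>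
     (\<forall>\<pi>. is_play E \<pi> \<and> consistent VO \<sigma> \<pi> \<and> (\<forall>i. \<pi> i \<in> D) \<longrightarrow> odd_wins p \<pi>)"

lemma play_post: "is_play E \<pi> \<Longrightarrow> \<pi> (Suc i) \<in> post E (\<pi> i)"
  by (simp add: is_play_def post_def)

text \<open>A play in \<open>D2\<close> follows \<open>\<sigma>2\<close> until it leaves
  \<open>S - D1\<close>, which within \<open>D1 \<union> D2\<close> can only mean entering
  \<open>D1\<close>. From then on \<open>\<sigma>1\<close> keeps it in \<open>D1\<close>, because
  the play never leaves \<open>S\<close>.\<close>

lemma odd_cert_union:
  assumes c1: "odd_cert E p VO D1 S \<sigma>1" and c2: "odd_cert E p VO D2 (S - D1) \<sigma>2"
    and D1: "D1 \<subseteq> S" and D2: "D2 \<subseteq> S - D1"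
  shows "odd_cert E p VO (D1 \<union> D2) S (\<lambda>x. if x \<in> D1 then \<sigma>1 x else \<sigma>2 x)"
    (is "odd_cert _ _ _ _ _ ?\<sigma>")
proof -
  have step: "if x \<in> VO then ?\<sigma> x \<in> post E x \<and> (?\<sigma> x \<in> D1 \<union> D2 \<or> ?\<sigma> x \<notin> S)
      else post E x \<inter> S \<subseteq> D1 \<union> D2" if "x \<in> D1 \<union> D2" for x
  proof (cases "x \<in> D1")
    case True
    then show ?thesis using c1 unfolding odd_cert_def by (auto split: if_splits)
  next
    case False
    with that have "x \<in> D2" by simp
    with False show ?thesis using c2 unfolding odd_cert_def by (auto split: if_splits)
  qed
  have "odd_wins p \<pi>"
    if pl: "is_play E \<pi>" and con: "consistent VO ?\<sigma> \<pi>" and D: "\<forall>i. \<pi> i \<in> D1 \<union> D2" for \<pi>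
  proof (cases "\<exists>n. \<pi> n \<in> D1")
    case True
    then obtain n where n: "\<pi> n \<in> D1" ..
    have inD1: "\<pi> (i + n) \<in> D1" for i
    proof (induction i)
      case (Suc i)
      have "\<pi> (Suc (i + n)) \<in> S" using D D1 D2 by blast
      moreover have "\<pi> (Suc (i + n)) = \<sigma>1 (\<pi> (i + n))" if "\<pi> (i + n) \<in> VO"
        using con that Suc by (simp add: consistent_def)
      ultimately have "\<pi> (Suc (i + n)) \<in> D1"
        using c1 Suc play_post[OF pl, of "i + n"] unfolding odd_cert_def
        by (cases "\<pi> (i + n) \<in> VO") force+
      then show ?case by simp
    qed (use n in simp)
    have "consistent VO \<sigma>1 (\<lambda>i. \<pi> (i + n))"
      by (rule consistent_cong[OF consistent_shift[OF con]]) (simp add: inD1)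
    then have "odd_wins p (\<lambda>i. \<pi> (i + n))"
      using c1 is_play_shift[OF pl] inD1 unfolding odd_cert_def by blast
    then show ?thesis by (simp only: odd_wins_shift)
  next
    case False
    then have "consistent VO \<sigma>2 \<pi>"
      by (intro consistent_cong[OF con]) simp
    then show ?thesis
      using c2 pl D False unfolding odd_cert_def by blast
  qed
  with step show ?thesis unfolding odd_cert_def by blast
qed

lemma if_ball_bex_mono:
  assumes "if b then \<forall>y\<in>S. P y else \<exists>y\<in>S. P y" "\<And>y. P y \<Longrightarrow> Q y"
  shows "if b then \<forall>y\<in>S. Q y else \<exists>y\<in>S. Q y"
  using assms by (auto split: if_splits)

text \<open>The second certificate is stacked on the first by adding to \<open>r2\<close> the
  largest vector \<open>c\<close> that \<open>r1\<close> may take. The sum respects the bounds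
  because the two regions are disjoint and their cardinalities add up.\<close>

lemma even_cert_union:
  assumes c1: "even_cert E p VO W1 T r1" and c2: "even_cert E p VO W2 (T \<union> W1) r2"
    and dj: "W1 \<inter> W2 = {}" and fin: "finite W1" "finite W2"
  shows "\<exists>r. even_cert E p VO (W1 \<union> W2) T r"
proof -
  define c where "c i = (if odd i then card {y\<in>W1. p y = i} else 0)" for i
  define r where "r x = (if x \<in> W1 then r1 x else (\<lambda>i. r2 x i + c i))" for x
  have card: "card {y\<in>W1 \<union> W2. p y = i} = card {y\<in>W1. p y = i} + card {y\<in>W2. p y = i}" for i
  proof -
    have "{y\<in>W1 \<union> W2. p y = i} = {y\<in>W1. p y = i} \<union> {y\<in>W2. p y = i}" by auto
    then show ?thesis using dj fin by (simp add: card_Un_disjoint disjoint_iff)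
  qed
  have r1c: "r1 x i \<le> c i" if "x \<in> W1" for x i
    using c1 that by (auto simp: even_cert_def c_def)
  have bound: "r x i \<le> (if odd i then card {y\<in>W1 \<union> W2. p y = i} else 0)"
    if "x \<in> W1 \<union> W2" for x i
  proof (cases "x \<in> W1")
    case True
    then show ?thesis using r1c[OF True, of i] card[of i] by (simp add: r_def c_def split: if_splits)
  next
    case False
    with that have "r2 x i \<le> (if odd i then card {y\<in>W2. p y = i} else 0)"
      using c2 by (simp add: even_cert_def)
    then show ?thesis using False card[of i] by (simp add: r_def c_def split: if_splits)
  qed
  let ?ok = "\<lambda>x y. y \<in> T \<and> progress (p x) (r x) (\<lambda>_. 0) \<or>
     y \<in> W1 \<union> W2 \<and> progress (p x) (r x) (r y)"
  have ok1: "?ok x y" if "x \<in> W1"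
    "y \<in> T \<and> progress (p x) (r1 x) (\<lambda>_. 0) \<or> y \<in> W1 \<and> progress (p x) (r1 x) (r1 y)" for x y
    using that by (auto simp: r_def)
  have ok2: "?ok x y" if "x \<in> W2"
    and y: "y \<in> T \<union> W1 \<and> progress (p x) (r2 x) (\<lambda>_. 0) \<or> y \<in> W2 \<and> progress (p x) (r2 x) (r2 y)"
    for x y
  proof -
    have rx: "r x = (\<lambda>i. r2 x i + c i)" using that dj by (auto simp: r_def)
    consider "y \<in> T \<union> W1" "progress (p x) (r2 x) (\<lambda>_. 0)" | "y \<in> W2" "progress (p x) (r2 x) (r2 y)"
      using y by blast
    then show ?thesis
    proof cases
      \<comment> \<open>One bound settles both kinds of target: \<open>c\<close> dominates the
        measure 0 of \<open>T\<close> as well as \<open>r1\<close> on \<open>W1\<close>.\<close>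
      case 1
      then have "progress (p x) (r x) g" if "\<And>i. g i \<le> c i" for g
        unfolding rx using that by (intro progress_add_pointwise)
      moreover have "r y i \<le> c i" if "y \<in> W1" for i
        using r1c[OF that] that by (simp add: r_def)
      ultimately show ?thesis using 1(1) by auto
    next
      case 2
      then have ry: "r y = (\<lambda>i. r2 y i + c i)" using dj by (auto simp: r_def)
      have "progress (p x) (r x) (r y)" unfolding rx ry by (rule progress_add[OF 2(2)])
      with 2(1) show ?thesis by blast
    qed
  qed
  have "if x \<in> VO then \<forall>y\<in>post E x. ?ok x y else \<exists>y\<in>post E x. ?ok x y" if "x \<in> W1 \<union> W2" for x
  proof (cases "x \<in> W1")
    case True
    then show ?thesis
      by (rule if_ball_bex_mono[OF c1[unfolded even_cert_def Let_def, THEN conjunct2, THEN bspec]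
            ok1[OF True]])
  next
    case False
    with that have "x \<in> W2" by simp
    then show ?thesis
      by (rule if_ball_bex_mono[OF c2[unfolded even_cert_def Let_def, THEN conjunct2, THEN bspec]
            ok2[OF \<open>x \<in> W2\<close>]])
  qed
  with bound have "even_cert E p VO (W1 \<union> W2) T r"
    unfolding even_cert_def Let_def by blast
  then show ?thesis by (intro exI[of _ r])
qed

lemma cert_empty: "even_cert E p VO {} T r" "odd_cert E p VO {} S \<sigma>"
  by (simp_all add: even_cert_def odd_cert_def)

text \<open>For odd \<open>p x\<close> a single unit at position \<open>p x\<close> gives the strict
  descent to the target, and the one vertex of that priority in \<open>{x}\<close> pays for
  it.\<close>

lemma even_cert_singleton:
  assumes "if x \<in> VO then post E x \<subseteq> T else post E x \<inter> T \<noteq> {}"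
  shows "even_cert E p VO {x} T (\<lambda>_ i. if odd i \<and> i = p x then 1 else 0)"
proof -
  have "progress (p x) (\<lambda>i. if odd i \<and> i = p x then 1 else 0) (\<lambda>_. 0)"
    by (auto simp: progress_def lex_lt_def)
  moreover have "card {y \<in> {x}. p y = p x} = 1"
    by (simp add: conj_commute cong: conj_cong)
  ultimately show ?thesis
    using assms unfolding even_cert_def Let_def by (auto split: if_splits)
qed

text \<open>Winning is vacuous: in both cases the next move leaves \<open>S\<close>, which contains
  \<open>x\<close>, so no consistent play stays in \<open>{x}\<close>.\<close>

lemma odd_cert_singleton:
  assumes "x \<in> S" "if x \<in> VO then y \<in> post E x - S else post E x \<inter> S = {}"
  shows "odd_cert E p VO {x} S (\<lambda>_. y)"
proof -
  have False if "is_play E \<pi>" "consistent VO (\<lambda>_. y) \<pi>" "\<forall>i. \<pi> i \<in> {x}" for \<pi>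
  proof -
    have "\<pi> (Suc 0) = x" "\<pi> 0 = x" using that(3) by auto
    then show False using play_post[OF that(1), of 0] that(2) assms
      by (auto simp: consistent_def split: if_splits)
  qed
  with assms show ?thesis unfolding odd_cert_def by (auto split: if_splits)
qed

text \<open>Zielonka's argument: make a vertex of least priority \<open>d\<close> a target of the player with the parity of
  \<open>d\<close>. If that player then wins all other vertices, it wins everywhere, since returning to the vertex
  is good for it; otherwise the opponent wins its region even against this target, hence in the whole
  game.\<close>

lemma determinacy_aux:
  assumes X: "finite X" "X \<noteq> {}" "X \<inter> T = {}"
    and IH: "\<And>Y T'. Y \<subset> X \<Longrightarrow> Y \<inter> T' = {} \<Longrightarrow> \<exists>W D r \<sigma>. W \<union> D = Y \<and> W \<inter> D = {} \<and>
       even_cert E p VO W T' r \<and> odd_cert E p VO D (Y \<union> T') \<sigma>"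
  shows "(\<exists>W r. W \<noteq> {} \<and> W \<subseteq> X \<and> even_cert E p VO W T r) \<or>
     (\<exists>D \<sigma>. D \<noteq> {} \<and> D \<subseteq> X \<and> odd_cert E p VO D (X \<union> T) \<sigma>)"
proof -
  define d where "d = Min (p ` X)"
  have dmin: "d \<le> p y" if "y \<in> X" for y using that X(1) by (simp add: d_def)
  have "d \<in> p ` X" using X unfolding d_def by (intro Min_in) auto
  then obtain x where x: "x \<in> X" "p x = d" by auto
  \<comment> \<open>In \<open>E\<close> and \<open>O\<close> one vertex is decided by a single move
    and forms a region of its own. Under \<open>N\<close> every vertex has a successor in
    \<open>X\<close>, Odd cannot leave \<open>X \<union> T\<close> and Even cannot enter
    \<open>T\<close>.\<close>
  consider
    (E) "\<exists>y\<in>X. if y \<in> VO then post E y \<subseteq> T else post E y \<inter> T \<noteq> {}"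
  | (O) "\<exists>y\<in>X. if y \<in> VO then \<not> post E y \<subseteq> X \<union> T else post E y \<inter> (X \<union> T) = {}"
  | (N) "\<And>y. y \<in> X \<Longrightarrow> if y \<in> VO then post E y \<subseteq> X \<union> T \<and> post E y \<inter> X \<noteq> {}
          else post E y \<inter> T = {} \<and> post E y \<inter> X \<noteq> {}"
  proof (cases "\<forall>y\<in>X. if y \<in> VO then post E y \<subseteq> X \<union> T \<and> post E y \<inter> X \<noteq> {}
          else post E y \<inter> T = {} \<and> post E y \<inter> X \<noteq> {}")
    case False
    then obtain y where "y \<in> X" "\<not> (if y \<in> VO then post E y \<subseteq> X \<union> T \<and> post E y \<inter> X \<noteq> {}
          else post E y \<inter> T = {} \<and> post E y \<inter> X \<noteq> {})" by blast
    then have "(if y \<in> VO then post E y \<subseteq> T else post E y \<inter> T \<noteq> {}) \<or>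
        (if y \<in> VO then \<not> post E y \<subseteq> X \<union> T else post E y \<inter> (X \<union> T) = {})"
      by (cases "y \<in> VO"; simp; blast)
    with \<open>y \<in> X\<close> that(1,2) show thesis by blast
  qed (use that(3) in blast)
  then show ?thesis
  proof cases
    case E
    then obtain y where y: "y \<in> X" "if y \<in> VO then post E y \<subseteq> T else post E y \<inter> T \<noteq> {}" ..
    from even_cert_singleton[OF y(2)] show ?thesis
      using y(1) by (intro disjI1 exI[of _ "{y}"]) auto
  next
    case O
    then obtain y where y: "y \<in> X"
      "if y \<in> VO then \<not> post E y \<subseteq> X \<union> T else post E y \<inter> (X \<union> T) = {}" ..
    then obtain z where "if y \<in> VO then z \<in> post E y - (X \<union> T) else post E y \<inter> (X \<union> T) = {}"
      by (auto split: if_splits)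
    from odd_cert_singleton[OF _ this] show ?thesis
      using y(1) by (intro disjI2 exI[of _ "{y}"]) auto
  next
    case N
    have sub: "X - {x} \<subset> X" using x by auto
    show ?thesis
    proof (cases "even d")
      case True
      \<comment> \<open>Since \<open>x\<close> joins the target, the arena together with its target
        is still \<open>X \<union> T\<close>, so a nonempty \<open>D\<close> is already a region of
        the original game.\<close>
      obtain W D r \<sigma> where *: "W \<union> D = X - {x}" "W \<inter> D = {}" "even_cert E p VO W (insert x T) r"
        "odd_cert E p VO D (X - {x} \<union> insert x T) \<sigma>"
        using IH[OF sub, of "insert x T"] X(3) by blast
      have S: "X - {x} \<union> insert x T = X \<union> T" using x by auto
      show ?thesis
      proof (cases "D = {}")
        case False
        moreover have "odd_cert E p VO D (X \<union> T) \<sigma>" using *(4) by (simp only: S)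
        ultimately show ?thesis using *(1) by blast
      next
        case True
        with * have W: "W = X - {x}" by simp
        \<comment> \<open>The value 0 works at \<open>x\<close>: its edges need only a non-strict
          comparison up to the even position \<open>d\<close>, where all measures vanish because no
          priority is below \<open>d\<close>. Edges into \<open>x\<close> made progress towards 0
          when \<open>x\<close> was a target.\<close>
        define r' where "r' = r(x := (\<lambda>_. 0))"
        have rb: "r y i \<le> (if odd i then card {z\<in>W. p z = i} else 0)" if "y \<in> W" for y i
          using *(3) that unfolding even_cert_def by blast
        have small: "r y i = 0" if "y \<in> W" "i < Suc d" for y i
        proof (cases "i = d")
          case False
          then have "{z\<in>W. p z = i} = {}" using dmin W that by force
          then have "card {z\<in>W. p z = i} = 0" by (simp only: card.empty)
          then show ?thesis using rb[OF that(1), of i] by (simp split: if_splits)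
        qed (use rb[OF that(1), of i] \<open>even d\<close> in simp)
        have bound: "r' y i \<le> (if odd i then card {z\<in>X. p z = i} else 0)" if "y \<in> X" for y i
        proof (cases "y = x")
          case False
          then have "y \<in> W" using W that by simp
          then have "r y i \<le> (if odd i then card {z\<in>W. p z = i} else 0)" by (rule rb)
          also have "\<dots> \<le> (if odd i then card {z\<in>X. p z = i} else 0)"
            using X(1) W by (auto intro!: card_mono)
          finally show ?thesis using False by (simp add: r'_def)
        qed (simp add: r'_def)
        let ?ok = "\<lambda>y z. z \<in> T \<and> progress (p y) (r' y) (\<lambda>_. 0) \<or> z \<in> X \<and> progress (p y) (r' y) (r' z)"
        have okx: "?ok x z" if "z \<in> X \<union> T" for z
          using that small W x \<open>even d\<close>
          by (cases "z = x") (auto simp: progress_def r'_def lex_lt_def)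
        have oky: "?ok y z" if "y \<in> W" "z \<in> insert x T \<and> progress (p y) (r y) (\<lambda>_. 0) \<or>
            z \<in> W \<and> progress (p y) (r y) (r z)" for y z
          using that W x(1) by (auto simp: r'_def)
        have "if y \<in> VO then \<forall>z\<in>post E y. ?ok y z else \<exists>z\<in>post E y. ?ok y z" if "y \<in> X" for y
        proof (cases "y = x")
          case True
          then show ?thesis using N[OF that] okx by (cases "x \<in> VO") (simp, blast)+
        next
          case False
          with that W have "y \<in> W" by simp
          then show ?thesis
            by (rule if_ball_bex_mono[OF *(3)[unfolded even_cert_def Let_def, THEN conjunct2,
                  THEN bspec] oky[OF \<open>y \<in> W\<close>]])
        qed
        with bound have "even_cert E p VO X T r'"
          unfolding even_cert_def Let_def by blast
        then show ?thesis using X(2) by blast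
      qed
    next
      case False
      \<comment> \<open>Now \<open>x\<close> lies outside \<open>X - {x} \<union> T\<close>, so
        moving to \<open>x\<close> counts as a success of Odd, and Even wins a nonempty
        \<open>W\<close> without entering \<open>x\<close>.\<close>
      obtain W D r \<sigma> where *: "W \<union> D = X - {x}" "W \<inter> D = {}" "even_cert E p VO W T r"
        "odd_cert E p VO D (X - {x} \<union> T) \<sigma>"
        using IH[OF sub, of T] X(3) by blast
      show ?thesis
      proof (cases "W = {}")
        case False
        then show ?thesis using * by blast
      next
        case True
        with * have D: "D = X - {x}" by simp
        obtain u where u: "u \<in> post E x" "u \<in> X" using N[OF x(1)] by (auto split: if_splits)
        define \<sigma>' where "\<sigma>' = \<sigma>(x := u)"
        have step: "if y \<in> VO then \<sigma>' y \<in> post E y \<and> (\<sigma>' y \<in> X \<or> \<sigma>' y \<notin> X \<union> T)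
          else post E y \<inter> (X \<union> T) \<subseteq> X" if "y \<in> X" for y
        proof (cases "y = x")
          case True
          then show ?thesis using N[OF x(1)] u by (auto simp: \<sigma>'_def)
        next
          case False
          with that D have "y \<in> D" by simp
          then show ?thesis using *(4) N[OF that] False D x unfolding odd_cert_def \<sigma>'_def
            by (auto split: if_splits)
        qed
        have "odd_wins p \<pi>"
          if pl: "is_play E \<pi>" and con: "consistent VO \<sigma>' \<pi>" and inX: "\<forall>i. \<pi> i \<in> X" for \<pi>
        proof (cases "\<exists>\<^sub>\<infinity>i. \<pi> i = x")
          case True
          then have "\<exists>\<^sub>\<infinity>i. p (\<pi> i) = d" by (rule frequently_elim1) (simp add: x)
          then show ?thesis using odd_wins_least[of d p \<pi>] dmin inX \<open>odd d\<close> by blast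
        next
          case False
          then obtain n where n: "\<And>i. n \<le> i \<Longrightarrow> \<pi> i \<noteq> x"
            by (auto simp: not_frequently cofinite_eq_sequentially eventually_sequentially)
          have inD: "\<pi> (i + n) \<in> D" for i using n inX D by simp
          have "consistent VO \<sigma> (\<lambda>i. \<pi> (i + n))"
            by (rule consistent_cong[OF consistent_shift[OF con]]) (simp add: n \<sigma>'_def)
          then have "odd_wins p (\<lambda>i. \<pi> (i + n))"
            using *(4) is_play_shift[OF pl] inD unfolding odd_cert_def by blast
          then show ?thesis by (simp only: odd_wins_shift)
        qed
        with step have "odd_cert E p VO X (X \<union> T) \<sigma>'"
          unfolding odd_cert_def by blast
        then show ?thesis using X(2) by blast
      qed
    qed
  qed
qed

text \<open>Regions from \<open>determinacy_aux\<close> are peeled off one at a time. An Even region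
  joins the target of the remaining game and an Odd region is cut out of the arena, as the two union
  lemmas expect.\<close>

lemma determinacy:
  assumes "finite X" "X \<inter> T = {}"
  shows "\<exists>W D r \<sigma>. W \<union> D = X \<and> W \<inter> D = {} \<and>
    even_cert E p VO W T r \<and> odd_cert E p VO D (X \<union> T) \<sigma>"
  using assms
proof (induction X arbitrary: T rule: finite_psubset_induct)
  case (psubset X)
  show ?case
  proof (cases "X = {}")
    case True
    then show ?thesis using cert_empty[of E p VO]
      by (intro exI[of _ "{}"] exI[of _ undefined]) simp
  next
    case False
    have "(\<exists>W r. W \<noteq> {} \<and> W \<subseteq> X \<and> even_cert E p VO W T r) \<or>
        (\<exists>D \<sigma>. D \<noteq> {} \<and> D \<subseteq> X \<and> odd_cert E p VO D (X \<union> T) \<sigma>)"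
      by (rule determinacy_aux[OF psubset(1) False psubset.prems]) (rule psubset.IH)
    then show ?thesis
    proof (elim disjE exE conjE)
      fix W r assume E: "W \<noteq> {}" "W \<subseteq> X" "even_cert E p VO W T r"
      have "X - W \<subset> X" "(X - W) \<inter> (T \<union> W) = {}" using E psubset.prems by auto
      from psubset.IH[OF this] obtain W2 D r2 \<sigma> where *: "W2 \<union> D = X - W" "W2 \<inter> D = {}"
        "even_cert E p VO W2 (T \<union> W) r2" "odd_cert E p VO D (X - W \<union> (T \<union> W)) \<sigma>" by blast
      have "finite W" "finite W2" "W \<inter> W2 = {}" using E * psubset(1)
        by (auto intro: finite_subset[of _ X])
      from even_cert_union[OF E(3) *(3) this(3,1,2)]
      obtain r' where "even_cert E p VO (W \<union> W2) T r'" ..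
      moreover have "X - W \<union> (T \<union> W) = X \<union> T" "(W \<union> W2) \<union> D = X" "(W \<union> W2) \<inter> D = {}"
        using E * by auto
      ultimately show ?thesis
        using *(4) by (intro exI[of _ "W \<union> W2"] exI[of _ D] exI[of _ r'] exI[of _ \<sigma>]) simp
    next
      fix D \<sigma> assume O: "D \<noteq> {}" "D \<subseteq> X" "odd_cert E p VO D (X \<union> T) \<sigma>"
      have "X - D \<subset> X" "(X - D) \<inter> T = {}" using O psubset.prems by auto
      from psubset.IH[OF this] obtain W D2 r \<sigma>2 where *: "W \<union> D2 = X - D" "W \<inter> D2 = {}"
        "even_cert E p VO W T r" "odd_cert E p VO D2 (X - D \<union> T) \<sigma>2" by blast
      have S: "X - D \<union> T = (X \<union> T) - D" using O psubset.prems by auto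
      have "odd_cert E p VO (D \<union> D2) (X \<union> T) (\<lambda>x. if x \<in> D then \<sigma> x else \<sigma>2 x)"
        by (rule odd_cert_union[OF O(3) *(4)[unfolded S]]) (use O * in auto)
      moreover have "W \<union> (D \<union> D2) = X" "W \<inter> (D \<union> D2) = {}"
        using O * by auto
      ultimately show ?thesis
        using *(3) by (intro exI[of _ W] exI[of _ "D \<union> D2"] exI[of _ r]
            exI[of _ "\<lambda>x. if x \<in> D then \<sigma> x else \<sigma>2 x"]) simp
    qed
  qed
qed

subsection \<open>Measures and lifting\<close>

lemma meas_le_refl: "meas_le a a"
  by (cases a) auto

lemma meas_le_linear: "meas_le a b \<or> meas_le b a"
proof -
  have "(x, y) \<in> lexord {(x::nat, y). x < y} \<or> x = y \<or> (y, x) \<in> lexord {(x, y). x < y}" for x y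
    by (rule lexord_linear) auto
  then show ?thesis by (cases a; cases b) auto
qed

lemma meas_le_antisym: "meas_le a b \<Longrightarrow> meas_le b a \<Longrightarrow> a = b"
proof -
  have "(y, x) \<notin> lexord {(x::nat, y). x < y}" if "(x, y) \<in> lexord {(x, y). x < y}" for x y
    by (rule asymD[OF lexord_asym that]) (auto intro: asymI)
  then show "meas_le a b \<Longrightarrow> meas_le b a \<Longrightarrow> a = b" by (cases a; cases b) auto
qed

lemma meas_le_trans:
  assumes "meas_le a b" "meas_le b c"
  shows "meas_le a c"
proof (cases c)
  case (Tup z)
  with assms(2) obtain y where y: "b = Tup y" by (cases b) auto
  with assms(1) obtain x where x: "a = Tup x" by (cases a) auto
  have "trans {(x::nat, y). x < y}" by (rule transI) simp
  from lexord_trans[OF _ _ this, of x y z] show ?thesis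
    using assms unfolding x y Tup meas_le.simps by metis
qed simp

text \<open>Keeping \<open>R\<close> abstract serves minima and, with the converse order,
  maxima.\<close>

lemma finite_has_bound:
  assumes "finite S" "S \<noteq> {}"
    and lin: "\<And>a b. R a b \<or> R b a" and trans: "\<And>a b c. R a b \<Longrightarrow> R b c \<Longrightarrow> R a c"
  shows "\<exists>m\<in>S. \<forall>m'\<in>S. R m m'"
  using assms(1,2)
proof (induction rule: finite_ne_induct)
  case (singleton x)
  then show ?case using lin[of x x] by simp
next
  case (insert x F)
  then obtain m where m: "m \<in> F" "\<forall>m'\<in>F. R m m'" by blast
  show ?case
  proof (cases "R m x")
    case True
    with m show ?thesis by (intro bexI[of _ m]) simp_all
  next
    case False
    then have "R x m" using lin by blast
    then have "\<forall>m'\<in>F. R x m'" using m trans by blast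
    then show ?thesis using lin[of x x] by (intro bexI[of _ x]) simp_all
  qed
qed

lemma meas_least_mem_le:
  assumes "finite S" "S \<noteq> {}"
  shows "meas_least S \<in> S" "\<forall>m\<in>S. meas_le (meas_least S) m"
proof -
  have "\<exists>m\<in>S. \<forall>m'\<in>S. meas_le m m'"
    by (rule finite_has_bound[OF assms]) (use meas_le_linear meas_le_trans in blast)+
  then have "\<exists>!m. m \<in> S \<and> (\<forall>m'\<in>S. meas_le m m')"
    using meas_le_antisym by blast
  from theI'[OF this] show "meas_least S \<in> S" "\<forall>m\<in>S. meas_le (meas_least S) m"
    unfolding meas_least_def by blast+
qed

lemma meas_greatest_mem_le:
  assumes "finite S" "S \<noteq> {}"
  shows "meas_greatest S \<in> S" "\<forall>m\<in>S. meas_le m (meas_greatest S)"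
proof -
  have "\<exists>m\<in>S. \<forall>m'\<in>S. meas_le m' m"
    by (rule finite_has_bound[OF assms]) (use meas_le_linear meas_le_trans in blast)+
  then have "\<exists>!m. m \<in> S \<and> (\<forall>m'\<in>S. meas_le m' m)"
    using meas_le_antisym by blast
  from theI'[OF this] show "meas_greatest S \<in> S" "\<forall>m\<in>S. meas_le m (meas_greatest S)"
    unfolding meas_greatest_def by blast+
qed

lemma lexord_iff_lex_lt:
  assumes "length a = n" "length b = n"
  shows "(a, b) \<in> lexord {(x, y). x < y} \<longleftrightarrow> lex_lt n ((!) a) ((!) b)"
proof -
  have "take i a = take i b \<longleftrightarrow> (\<forall>j<i. a ! j = b ! j)" if "i < n" for i
    using assms that by (auto simp: list_eq_iff_nth_eq)
  then show ?thesis
    using assms by (auto simp: lexord_take_index_conv lex_lt_def)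
qed

lemma meas_le_Tup_iff:
  assumes "length a = n" "length b = n"
  shows "meas_le (Tup a) (Tup b) \<longleftrightarrow> \<not> lex_lt n ((!) b) ((!) a)"
proof -
  have "a = b \<longleftrightarrow> (\<forall>i<n. a ! i = b ! i)"
    using assms by (auto simp: list_eq_iff_nth_eq)
  then show ?thesis
    using lex_lt_linear[of n "(!) a" "(!) b"] lex_lt_asym[of n "(!) a" "(!) b"]
    by (auto simp: lexord_iff_lex_lt[OF assms] lexord_iff_lex_lt[OF assms(2,1)])
qed

lemma meas_le_k_Tup_iff:
  assumes "length a = n" "length b = n" "i < n"
  shows "meas_le_k i (Tup a) (Tup b) \<longleftrightarrow> \<not> lex_lt (Suc i) ((!) b) ((!) a)"
proof -
  have "lex_lt (Suc i) ((!) (take (Suc i) b)) ((!) (take (Suc i) a)) = lex_lt (Suc i) ((!) b) ((!) a)"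
    by (rule lex_lt_cong) auto
  then show ?thesis
    unfolding meas_le_k_def trunc.simps
    using meas_le_Tup_iff[of "take (Suc i) a" "Suc i" "take (Suc i) b"] assms by simp
qed

lemma meas_lt_k_Tup_iff:
  assumes "length a = n" "length b = n" "i < n"
  shows "meas_lt_k i (Tup a) (Tup b) \<longleftrightarrow> lex_lt (Suc i) ((!) a) ((!) b)"
proof -
  have "meas_lt_k i (Tup a) (Tup b) \<longleftrightarrow> \<not> meas_le_k i (Tup b) (Tup a)"
    unfolding meas_lt_k_def meas_lt_def meas_le_k_def
    using meas_le_linear meas_le_antisym meas_le_refl by metis
  then show ?thesis using assms by (simp add: meas_le_k_Tup_iff)
qed

section \<open>\<open>Prog\<close> and \<open>Lift\<close> in a fixed parity game\<close>

locale parity_arena =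
  fixes V :: "'v set" and E p VE VO
  assumes game: "parity_game V E p VE VO"
begin

lemma finV: "finite V" and postV: "post E x \<subseteq> V" and VEVO: "VE \<inter> VO = {}" "VE \<union> VO = V"
  using game unfolding parity_game_def post_def by auto

lemma post_nonempty: "x \<in> V \<Longrightarrow> post E x \<noteq> {}"
  using game unfolding parity_game_def by auto

lemma finite_post: "finite (post E x)"
  using finite_subset[OF postV finV] .

abbreviation N :: nat where "N \<equiv> num_prios V p"

definition cap :: "nat \<Rightarrow> nat" where
  "cap i = (if odd i then card {y\<in>V. p y = i} else 0)"

lemma prio_less: "x \<in> V \<Longrightarrow> p x < N"
  using finV by (simp add: num_prios_def less_Suc_eq_le)

lemma Tup_dom_iff: "Tup m \<in> meas_dom V p \<longleftrightarrow> length m = N \<and> (\<forall>i<N. m ! i \<le> cap i)"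
  by (auto simp: meas_dom_def cap_def)

lemma finite_meas_dom: "finite (meas_dom V p)"
proof -
  have "finite {m. set m \<subseteq> {..Max (cap ` {..<N})} \<and> length m = N}"
    by (rule finite_lists_length_eq) simp
  moreover have "set m \<subseteq> {..Max (cap ` {..<N})}" if m: "length m = N" "\<forall>i<N. m ! i \<le> cap i" for m
  proof
    fix y assume "y \<in> set m"
    then obtain i where i: "i < N" "y = m ! i" using m(1) by (auto simp: in_set_conv_nth)
    then have "y \<le> cap i" "cap i \<le> Max (cap ` {..<N})" using m(2) by simp_all
    then show "y \<in> {..Max (cap ` {..<N})}" by simp
  qed
  ultimately have "finite {m. length m = N \<and> (\<forall>i<N. m ! i \<le> cap i)}"
    by (elim finite_subset[rotated]) auto
  then have "finite (insert Top (Tup ` {m. length m = N \<and> (\<forall>i<N. m ! i \<le> cap i)}))" by simp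
  moreover have "meas_dom V p \<subseteq> insert Top (Tup ` {m. length m = N \<and> (\<forall>i<N. m ! i \<le> cap i)})"
    using Tup_dom_iff by (auto simp: image_iff) (metis meas.exhaust)+
  ultimately show ?thesis by (rule finite_subset[rotated])
qed

text \<open>If \<open>\<rho> w\<close> is a tuple, \<open>Top\<close> satisfies the condition of
  \<open>Prog\<close> for either parity, so the two parities differ only in \<open>progress\<close>
  and there is always a candidate.\<close>

lemma Prog_eq:
  assumes "x \<in> V" "\<rho> w = Tup g" "length g = N"
  shows "Prog V p \<rho> x w =
    meas_least (insert Top {Tup f | f. Tup f \<in> meas_dom V p \<and> progress (p x) ((!) f) ((!) g)})"
proof -
  have len: "length f = N" if "Tup f \<in> meas_dom V p" for f using that Tup_dom_iff by simp
  have Top: "Top \<in> meas_dom V p" by (simp add: meas_dom_def)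
  have "{m \<in> meas_dom V p. meas_le_k (p x) (\<rho> w) m} =
      insert Top {Tup f | f. Tup f \<in> meas_dom V p \<and> \<not> lex_lt (Suc (p x)) ((!) f) ((!) g)}" (is "?A = ?B")
  proof (rule set_eqI)
    fix m
    show "m \<in> ?A \<longleftrightarrow> m \<in> ?B"
      using Top len assms meas_le_k_Tup_iff[OF assms(3) len prio_less]
      by (cases m) (auto simp: meas_le_k_def)
  qed
  moreover have "{m \<in> meas_dom V p. meas_lt_k (p x) (\<rho> w) m \<or> (m = Top \<and> \<rho> w = Top)} =
      insert Top {Tup f | f. Tup f \<in> meas_dom V p \<and> lex_lt (Suc (p x)) ((!) g) ((!) f)}" (is "?A = ?B")
  proof (rule set_eqI)
    fix m
    show "m \<in> ?A \<longleftrightarrow> m \<in> ?B"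
      using Top len assms meas_lt_k_Tup_iff[OF assms(3) len prio_less]
      by (cases m) (auto simp: meas_lt_k_def meas_lt_def)
  qed
  ultimately show ?thesis unfolding Prog_def progress_def by simp
qed

lemma Prog_props:
  assumes "x \<in> V" "\<rho> w = Tup g" "length g = N"
  shows Prog_cases: "Prog V p \<rho> x w = Top \<or> (\<exists>f. Prog V p \<rho> x w = Tup f \<and>
      Tup f \<in> meas_dom V p \<and> progress (p x) ((!) f) ((!) g))"
    and Prog_le: "\<And>f. Tup f \<in> meas_dom V p \<Longrightarrow> progress (p x) ((!) f) ((!) g) \<Longrightarrow>
      meas_le (Prog V p \<rho> x w) (Tup f)"
proof -
  let ?S = "insert Top {Tup f | f. Tup f \<in> meas_dom V p \<and> progress (p x) ((!) f) ((!) g)}"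
  have "finite ?S"
    by (rule finite_subset[OF _ finite_insert[THEN iffD2, OF finite_meas_dom]]) auto
  note * = meas_least_mem_le[OF this, folded Prog_eq[where \<rho>=\<rho> and w=w, OF assms]]
  show "Prog V p \<rho> x w = Top \<or> (\<exists>f. Prog V p \<rho> x w = Tup f \<and>
      Tup f \<in> meas_dom V p \<and> progress (p x) ((!) f) ((!) g))"
    using *(1) by blast
  show "meas_le (Prog V p \<rho> x w) (Tup f)"
    if "Tup f \<in> meas_dom V p" "progress (p x) ((!) f) ((!) g)" for f
    using *(2) that by blast
qed

text \<open>The condition compares positions up to \<open>p x\<close> only. Clearing the later
  entries of \<open>f\<close> gives another candidate \<open>h\<close>, not larger than
  \<open>f\<close>, and minimality forces \<open>f = h\<close>.\<close>

lemma Prog_zero: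
  assumes "x \<in> V" "\<rho> w = Tup g" "length g = N" "Prog V p \<rho> x w = Tup f" "p x < i" "i < N"
  shows "f ! i = 0"
proof -
  have f: "Tup f \<in> meas_dom V p" "progress (p x) ((!) f) ((!) g)"
    using Prog_cases[where \<rho>=\<rho> and w=w, OF assms(1-3)] assms(4) by auto
  define h where "h = map (\<lambda>i. if i \<le> p x then f ! i else 0) [0..<N]"
  have hn: "h ! i = (if i \<le> p x then f ! i else 0)" if "i < N" for i
    using that by (simp add: h_def)
  have h: "length h = N" by (simp add: h_def)
  have "Tup h \<in> meas_dom V p"
    using f(1) hn h by (auto simp: Tup_dom_iff)
  moreover have "\<forall>i<Suc (p x). h ! i = f ! i" using hn prio_less[OF assms(1)] by auto
  then have "progress (p x) ((!) h) ((!) g)"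
    using f(2) lex_lt_cong[of "Suc (p x)" "(!) h" "(!) f" "(!) g" "(!) g"]
      lex_lt_cong[of "Suc (p x)" "(!) g" "(!) g" "(!) h" "(!) f"]
    unfolding progress_def by simp
  ultimately have "meas_le (Tup f) (Tup h)"
    using Prog_le[where \<rho>=\<rho> and w=w, OF assms(1-3)] assms(4) by simp
  moreover have "length f = N" using f(1) by (simp add: Tup_dom_iff)
  moreover have "\<not> lex_lt N ((!) f) ((!) h)"
    by (rule lex_le_pointwise) (simp add: hn)
  ultimately have "f = h"
    using meas_le_antisym[of "Tup f" "Tup h"] meas_le_Tup_iff[of h N f] h by simp
  then show ?thesis using hn[OF assms(6)] assms(5) by simp
qed

lemma Lift_other: "y \<noteq> x \<Longrightarrow> Lift V E p VE VO \<rho> x y = \<rho> y"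
  by (simp add: Lift_def)

lemma Lift_mem:
  assumes "x \<in> V"
  shows "Lift V E p VE VO \<rho> x x \<in> insert (\<rho> x) (Prog V p \<rho> x ` post E x)"
  using meas_greatest_mem_le(1)[of "{\<rho> x, meas_least (Prog V p \<rho> x ` post E x)}"]
    meas_greatest_mem_le(1)[of "{\<rho> x, meas_greatest (Prog V p \<rho> x ` post E x)}"]
    meas_least_mem_le(1)[of "Prog V p \<rho> x ` post E x"]
    meas_greatest_mem_le(1)[of "Prog V p \<rho> x ` post E x"] post_nonempty[OF assms] finite_post
  unfolding Lift_def by (cases "x \<in> VE") auto

text \<open>The third premise has the shape of the edge condition in \<open>even_cert\<close>, so
  that a certificate can be plugged in directly.\<close>

lemma Lift_le:
  assumes "x \<in> V" "meas_le (\<rho> x) m"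
    and "if x \<in> VO then \<forall>w\<in>post E x. meas_le (Prog V p \<rho> x w) m
      else \<exists>w\<in>post E x. meas_le (Prog V p \<rho> x w) m"
  shows "meas_le (Lift V E p VE VO \<rho> x x) m"
proof (cases "x \<in> VO")
  case True
  then have "Lift V E p VE VO \<rho> x x = meas_greatest {\<rho> x, meas_greatest (Prog V p \<rho> x ` post E x)}"
    using VEVO by (auto simp: Lift_def)
  moreover have "meas_le (meas_greatest (Prog V p \<rho> x ` post E x)) m"
    using meas_greatest_mem_le(1)[of "Prog V p \<rho> x ` post E x"] post_nonempty[OF assms(1)]
      finite_post assms(3) True by force
  ultimately show ?thesis
    using meas_greatest_mem_le(1)[of "{\<rho> x, meas_greatest (Prog V p \<rho> x ` post E x)}"] assms(2)
    by auto
next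
  case False
  then have "Lift V E p VE VO \<rho> x x = meas_greatest {\<rho> x, meas_least (Prog V p \<rho> x ` post E x)}"
    using VEVO assms(1) by (auto simp: Lift_def)
  moreover have "meas_le (meas_least (Prog V p \<rho> x ` post E x)) m"
    using meas_least_mem_le(2)[of "Prog V p \<rho> x ` post E x"] post_nonempty[OF assms(1)]
      finite_post assms(3) False meas_le_trans by fastforce
  ultimately show ?thesis
    using meas_greatest_mem_le(1)[of "{\<rho> x, meas_least (Prog V p \<rho> x ` post E x)}"] assms(2)
    by auto
qed

end

text \<open>The vertices of \<open>W\<close> are won by Even in the game stopped on reaching priorities below \<open>k\<close>. There a
  measure that has never been \<open>Top\<close> stays below the certificate preceded by maximal entries at the
  positions below \<open>k\<close>, since stopping vertices have zeros from position \<open>k\<close> on.\<close>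

locale even_cert_arena = parity_arena +
  fixes k W r
  assumes W: "W \<subseteq> {x\<in>V. k \<le> p x}"
    and cert: "even_cert E p VO W {x\<in>V. p x < k} r"
begin

definition \<mu> :: "'a \<Rightarrow> nat list" where
  "\<mu> x = map (\<lambda>i. if i < k then cap i else r x i) [0..<N]"

lemma \<mu>_nth: "i < N \<Longrightarrow> \<mu> x ! i = (if i < k then cap i else r x i)"
  by (simp add: \<mu>_def)

lemma length_\<mu>: "length (\<mu> x) = N"
  by (simp add: \<mu>_def)

lemma r_le: "x \<in> W \<Longrightarrow> r x i \<le> (if odd i then card {y\<in>W. p y = i} else 0)"
  using cert unfolding even_cert_def by blast

lemma r_le_cap: "x \<in> W \<Longrightarrow> r x i \<le> cap i"
proof -
  assume "x \<in> W"
  have "card {y\<in>W. p y = i} \<le> card {y\<in>V. p y = i}"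
    using W finV by (intro card_mono) auto
  then show ?thesis using r_le[OF \<open>x \<in> W\<close>, of i] by (simp add: cap_def split: if_splits)
qed

lemma \<mu>_dom: "x \<in> W \<Longrightarrow> Tup (\<mu> x) \<in> meas_dom V p"
  using r_le_cap by (simp add: Tup_dom_iff \<mu>_nth length_\<mu>)

text \<open>The invariant of the lifting sequence before the first \<open>Top\<close>. Its zeros
  beyond the priority of a vertex are what makes stopping vertices comparable with the
  certificate.\<close>

definition bounded :: "('a \<Rightarrow> meas) \<Rightarrow> bool" where
  "bounded \<rho> \<longleftrightarrow>
     (\<forall>x\<in>V. \<exists>m. \<rho> x = Tup m \<and> Tup m \<in> meas_dom V p \<and> (\<forall>i<N. p x < i \<longrightarrow> m ! i = 0)) \<and>
     (\<forall>x\<in>W. meas_le (\<rho> x) (Tup (\<mu> x)))"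

lemma bounded_tup: "bounded \<rho> \<Longrightarrow> x \<in> V \<Longrightarrow> \<exists>g. \<rho> x = Tup g"
  unfolding bounded_def by blast

lemma bounded_nth:
  assumes "bounded \<rho>" "x \<in> V" "\<rho> x = Tup g"
  shows "length g = N" "i < N \<Longrightarrow> g ! i \<le> cap i" "i < N \<Longrightarrow> p x < i \<Longrightarrow> g ! i = 0"
  using assms unfolding bounded_def Tup_dom_iff by force+

text \<open>\<open>W\<close> has no priorities below \<open>k\<close>, so \<open>r x\<close>
  vanishes there and \<open>\<mu> x\<close> agrees with \<open>r x + ?c\<close> up to
  \<open>p x\<close>. Progress survives adding \<open>?c\<close> on both sides, and \<open>g\<close>
  is pointwise below the shifted target.\<close>

lemma progress_\<mu>:
  assumes "x \<in> W" "progress (p x) (r x) s"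
    "\<And>i. i < Suc (p x) \<Longrightarrow> g i \<le> (if i < k then cap i else s i)"
  shows "progress (p x) ((!) (\<mu> x)) g"
proof -
  have "x \<in> V" using assms(1) W by auto
  have small: "r x i = 0" if "i < k" for i
  proof -
    have "{y\<in>W. p y = i} = {}" using W that by auto
    then have "card {y\<in>W. p y = i} = 0" by (simp only: card.empty)
    then show ?thesis using r_le[OF assms(1), of i] by (simp split: if_splits)
  qed
  let ?c = "\<lambda>i. if i < k then cap i else 0"
  have "progress (p x) (\<lambda>i. r x i + ?c i) (\<lambda>i. s i + ?c i)"
    by (rule progress_add[OF assms(2)])
  then have "progress (p x) (\<lambda>i. r x i + ?c i) g"
    by (rule progress_le_trans) (rule lex_le_pointwise, use assms(3) in \<open>force split: if_splits\<close>)
  moreover have "\<forall>i<Suc (p x). \<mu> x ! i = r x i + ?c i"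
    using prio_less[OF \<open>x \<in> V\<close>] small by (auto simp: \<mu>_nth)
  ultimately show ?thesis
    using lex_lt_cong[of "Suc (p x)" "(!) (\<mu> x)" "\<lambda>i. r x i + ?c i" g g]
      lex_lt_cong[of "Suc (p x)" g g "(!) (\<mu> x)" "\<lambda>i. r x i + ?c i"]
    unfolding progress_def by simp
qed

text \<open>An edge accepted by the certificate makes \<open>\<mu> x\<close> a candidate for
  \<open>Prog\<close>. For a stopping vertex this uses the zeros of \<open>\<rho> y\<close> from
  \<open>k\<close> on, for a vertex of \<open>W\<close> the bound of \<open>\<rho> y\<close> by
  \<open>\<mu> y\<close>.\<close>

lemma progress_prog_le:
  assumes "bounded \<rho>" "x \<in> W" "y \<in> V"
    and ok: "p y < k \<and> progress (p x) (r x) (\<lambda>_. 0) \<or> y \<in> W \<and> progress (p x) (r x) (r y)"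
  shows "meas_le (Prog V p \<rho> x y) (Tup (\<mu> x))"
proof -
  have xV: "x \<in> V" using assms(2) W by auto
  then have px: "Suc (p x) \<le> N" using prio_less by (simp add: Suc_le_eq)
  obtain g where g1: "\<rho> y = Tup g" using bounded_tup[OF assms(1,3)] ..
  note g = g1 bounded_nth[OF assms(1,3) g1]
  have "progress (p x) ((!) (\<mu> x)) ((!) g)"
  proof (rule disjE[OF ok])
    assume *: "p y < k \<and> progress (p x) (r x) (\<lambda>_. 0)"
    show ?thesis
      by (rule progress_\<mu>[OF assms(2), of "\<lambda>_. 0"]) (use * g(3,4) px in auto)
  next
    assume *: "y \<in> W \<and> progress (p x) (r x) (r y)"
    then have "progress (p x) ((!) (\<mu> x)) ((!) (\<mu> y))"
      by (intro progress_\<mu>[OF assms(2), of "r y"]) (use px in \<open>auto simp: \<mu>_nth\<close>)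
    moreover have "\<not> lex_lt N ((!) (\<mu> y)) ((!) g)"
      using assms(1) * g(1) meas_le_Tup_iff[OF g(2) length_\<mu>] unfolding bounded_def by auto
    then have "\<not> lex_lt (Suc (p x)) ((!) (\<mu> y)) ((!) g)"
      using lex_lt_mono px by blast
    ultimately show ?thesis by (rule progress_le_trans)
  qed
  then show ?thesis
    by (rule Prog_le[where \<rho>=\<rho> and w=y, OF xV g(1,2) \<mu>_dom[OF assms(2)]])
qed

text \<open>A changed value is a \<open>Prog\<close> value, hence in the domain and zero beyond the
  priority of \<open>x\<close>. On \<open>W\<close> the certificate bounds all \<open>Prog\<close>
  values for Odd and one for Even, matching the maximum and the minimum in
  \<open>Lift\<close>.\<close>

lemma bounded_Lift:
  assumes "bounded \<rho>" "x \<in> V" "Lift V E p VE VO \<rho> x x \<noteq> Top"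
  shows "bounded (Lift V E p VE VO \<rho> x)"
proof -
  let ?\<rho> = "Lift V E p VE VO \<rho> x"
  have 1: "\<exists>m. ?\<rho> x = Tup m \<and> Tup m \<in> meas_dom V p \<and> (\<forall>i<N. p x < i \<longrightarrow> m ! i = 0)"
  proof (cases "?\<rho> x = \<rho> x")
    case True
    then show ?thesis using assms(1,2) unfolding bounded_def by simp
  next
    case False
    then obtain w where w: "w \<in> post E x" "?\<rho> x = Prog V p \<rho> x w"
      using Lift_mem[OF assms(2), of \<rho>] by auto
    then have "w \<in> V" using postV by auto
    from bounded_tup[OF assms(1) this] obtain g where g1: "\<rho> w = Tup g" ..
    note g = g1 bounded_nth(1)[OF assms(1) \<open>w \<in> V\<close> g1]
    obtain f where f: "Prog V p \<rho> x w = Tup f" "Tup f \<in> meas_dom V p"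
      using Prog_cases[where \<rho>=\<rho> and w=w, OF assms(2) g] assms(3) w(2) by auto
    with Prog_zero[where \<rho>=\<rho> and w=w, OF assms(2) g f(1)] w(2) show ?thesis by simp
  qed
  have 2: "meas_le (?\<rho> x) (Tup (\<mu> x))" if "x \<in> W"
  proof (rule Lift_le[OF assms(2)])
    show "meas_le (\<rho> x) (Tup (\<mu> x))" using assms(1) that unfolding bounded_def by simp
    have "if x \<in> VO
      then \<forall>y\<in>post E x. y \<in> {x\<in>V. p x < k} \<and> progress (p x) (r x) (\<lambda>_. 0) \<or>
        y \<in> W \<and> progress (p x) (r x) (r y)
      else \<exists>y\<in>post E x. y \<in> {x\<in>V. p x < k} \<and> progress (p x) (r x) (\<lambda>_. 0) \<or>
        y \<in> W \<and> progress (p x) (r x) (r y)"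
      by (rule cert[unfolded even_cert_def Let_def, THEN conjunct2, THEN bspec, OF that])
    then show "if x \<in> VO then \<forall>w\<in>post E x. meas_le (Prog V p \<rho> x w) (Tup (\<mu> x))
      else \<exists>w\<in>post E x. meas_le (Prog V p \<rho> x w) (Tup (\<mu> x))"
    proof (rule if_ball_bex_mono)
      fix y assume *: "y \<in> {x\<in>V. p x < k} \<and> progress (p x) (r x) (\<lambda>_. 0) \<or>
        y \<in> W \<and> progress (p x) (r x) (r y)"
      then have "y \<in> V" using W by blast
      then show "meas_le (Prog V p \<rho> x y) (Tup (\<mu> x))"
        by (rule progress_prog_le[OF assms(1) that]) (use * in blast)
    qed
  qed
  show ?thesis
    unfolding bounded_def
  proof (intro conjI ballI)
    fix y assume "y \<in> V"
    then show "\<exists>m. ?\<rho> y = Tup m \<and> Tup m \<in> meas_dom V p \<and> (\<forall>i<N. p y < i \<longrightarrow> m ! i = 0)"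
      using 1 assms(1) unfolding bounded_def by (cases "y = x") (simp_all add: Lift_other)
  next
    fix y assume "y \<in> W"
    then show "meas_le (?\<rho> y) (Tup (\<mu> y))"
      using 2 assms(1) unfolding bounded_def by (cases "y = x") (simp_all add: Lift_other)
  qed
qed

lemma bounded_init: "bounded (\<lambda>_. Tup (replicate N 0))"
  unfolding bounded_def Tup_dom_iff
  by (auto simp: meas_le_Tup_iff[OF length_replicate length_\<mu>] simp del: meas_le.simps
      intro!: lex_le_pointwise)

lemma bounded_sequence:
  assumes "lifting_sequence V E p VE VO \<rho>s vs n" "\<forall>j<n. \<forall>w\<in>V. \<rho>s j w \<noteq> Top" "j < n"
  shows "bounded (\<rho>s j)"
  using assms(3)
proof (induction j)
  case 0
  then show ?case using assms(1) bounded_init by (simp add: lifting_sequence_def)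
next
  case (Suc j)
  then have *: "vs j \<in> V" "\<rho>s (Suc j) = Lift V E p VE VO (\<rho>s j) (vs j)"
    using assms(1) unfolding lifting_sequence_def by auto
  with Suc assms(2) show ?case using bounded_Lift[of "\<rho>s j" "vs j"] by auto
qed

text \<open>The vertex \<open>v\<close> causes the gap. It has priority \<open>k\<close> and is not
  in \<open>W\<close>, so \<open>W\<close> has fewer vertices of priority \<open>k\<close> than
  \<open>V\<close> and \<open>\<mu> y\<close> is below \<open>cap\<close> at \<open>k\<close>. For
  \<open>p y < k\<close> the entry at \<open>k\<close> is 0, while \<open>cap k\<close> is
  positive.\<close>

lemma unsaturated:
  assumes "bounded \<rho>" "v \<in> V" "v \<notin> W" "p v = k" "odd k"
    and y: "y \<in> V" "y \<in> W \<or> p y < k" and g: "\<rho> y = Tup g"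
  shows "lex_lt (Suc k) ((!) g) cap"
proof -
  have k: "Suc k \<le> N" using prio_less[OF assms(2)] assms(4) by simp
  note g' = bounded_nth[OF assms(1) y(1) g]
  show ?thesis
  proof (cases "y \<in> W")
    case True
    have "{z\<in>W. p z = k} \<subset> {z\<in>V. p z = k}" using W assms(2,3,4) by auto
    then have "card {z\<in>W. p z = k} < card {z\<in>V. p z = k}"
      using finV by (intro psubset_card_mono) auto
    then have "\<mu> y ! k < cap k"
      using r_le[OF True, of k] k \<open>odd k\<close> by (simp add: \<mu>_nth cap_def)
    moreover have "\<forall>j<k. \<mu> y ! j = cap j" using k by (simp add: \<mu>_nth)
    ultimately have "lex_lt (Suc k) ((!) (\<mu> y)) cap" unfolding lex_lt_def by blast
    moreover have "\<not> lex_lt N ((!) (\<mu> y)) ((!) g)"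
      using assms(1) True g meas_le_Tup_iff[OF g'(1) length_\<mu>] unfolding bounded_def by auto
    then have "\<not> lex_lt (Suc k) ((!) (\<mu> y)) ((!) g)" using lex_lt_mono k by blast
    ultimately show ?thesis by (rule lex_le_lt_trans[rotated])
  next
    case False
    have "\<not> lex_lt (Suc k) cap ((!) g)"
      by (rule lex_le_pointwise) (use g'(2) k in simp)
    moreover have "{z\<in>V. p z = k} \<noteq> {}" using assms(2,4) by auto
    then have "0 < cap k" using finV \<open>odd k\<close> by (simp add: cap_def card_gt_0_iff)
    then have "g ! k \<noteq> cap k" using g'(3)[of k] k False y(2) by simp
    ultimately show ?thesis using lex_lt_linear[of "Suc k" "(!) g" cap] by blast
  qed
qed

text \<open>For even \<open>k\<close> the tuple \<open>g\<close> itself would be a candidate for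
  \<open>Prog\<close>; for odd \<open>k\<close> the tuple of all caps would be one if
  \<open>g\<close> were smaller up to \<open>k\<close>. Either would keep \<open>Prog\<close> from
  being \<open>Top\<close>.\<close>

lemma saturated:
  assumes "bounded \<rho>" "v \<in> V" "p v = k" "w \<in> V" "Prog V p \<rho> v w = Top" and g: "\<rho> w = Tup g"
  shows "odd k \<and> \<not> lex_lt (Suc k) ((!) g) cap"
proof -
  have k: "Suc k \<le> N" using prio_less[OF assms(2)] assms(3) by simp
  note gN = bounded_nth(1,2)[OF assms(1,4) g]
  have *: "\<not> progress k ((!) f) ((!) g)" if "length f = N" "\<And>i. i < N \<Longrightarrow> f ! i \<le> cap i" for f
    using Prog_le[where \<rho>=\<rho> and w=w, OF assms(2) g gN(1), of f] assms(3,5) that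
    by (auto simp: Tup_dom_iff)
  from *[OF gN] have "odd k" using lex_lt_asym unfolding progress_def by (auto split: if_splits)
  moreover have "lex_lt (Suc k) ((!) g) ((!) (map cap [0..<N])) = lex_lt (Suc k) ((!) g) cap"
    by (rule lex_lt_cong) (use k in auto)
  ultimately show ?thesis
    using *[of "map cap [0..<N]"] unfolding progress_def by simp
qed

text \<open>The last lift raises \<open>v\<close> to \<open>Top\<close>, which needs
  \<open>Prog\<close> to be \<open>Top\<close> for every successor if Even moves and for some
  successor if Odd moves. Saturation passes from that successor to a maximal one. The alternative
  \<open>u = v\<close> covers a self-loop, whose value is already \<open>Top\<close>.\<close>

lemma top_successors:
  assumes lift: "lifting_sequence V E p VE VO \<rho>s vs n" and vV: "v \<in> V" and top: "\<rho>s n v = Top"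
    and first: "\<forall>j<n. \<forall>w\<in>V. \<rho>s j w \<noteq> Top"
    and v: "v \<notin> W" "p v = k"
  shows "odd k" "v \<in> VE \<Longrightarrow> w \<in> post E v \<Longrightarrow> w \<notin> W \<and> k \<le> p w"
    "v \<in> VO \<Longrightarrow> u \<in> post E v \<Longrightarrow> \<forall>w\<in>post E v. meas_le (\<rho>s n w) (\<rho>s n u) \<Longrightarrow>
       u = v \<or> u \<notin> W \<and> k \<le> p u"
proof -
  have "n \<noteq> 0"
  proof
    assume "n = 0"
    then show False using top lift by (simp add: lifting_sequence_def)
  qed
  then obtain m where m: "n = Suc m" by (cases n) auto
  let ?\<rho> = "\<rho>s m"
  have b: "bounded ?\<rho>" using bounded_sequence[OF lift first] m by simp
  have \<rho>n: "\<rho>s n = Lift V E p VE VO ?\<rho> (vs m)"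
    using lift m by (auto simp: lifting_sequence_def)
  have nt: "?\<rho> w \<noteq> Top" if "w \<in> V" for w using first that m by blast
  \<comment> \<open>A lift changes one vertex only, and \<open>v\<close> was not \<open>Top\<close>
    before it.\<close>
  have "vs m = v"
    using Lift_other[of v "vs m" ?\<rho>] \<rho>n top nt[OF vV] by auto
  note \<rho>n = \<rho>n[unfolded this]
  have good: "odd k" "w \<notin> W \<and> k \<le> p w" if "w \<in> post E v" "Prog V p ?\<rho> v w = Top" for w
  proof -
    have wV: "w \<in> V" using that(1) postV by auto
    then obtain g where g: "?\<rho> w = Tup g" using nt meas.exhaust by metis
    from saturated[OF b vV v(2) wV that(2) g] show "odd k" "w \<notin> W \<and> k \<le> p w"
      using unsaturated[OF b vV v _ wV _ g] by fastforce+
  qed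
  have PE: "Prog V p ?\<rho> v w = Top" if "v \<in> VE" "w \<in> post E v" for w
  proof (rule ccontr)
    assume nT: "Prog V p ?\<rho> v w \<noteq> Top"
    obtain f where f: "Prog V p ?\<rho> v w = Tup f" using nT by (cases "Prog V p ?\<rho> v w") auto
    obtain h where h: "?\<rho> v = Tup h" using nt[OF vV] by (cases "?\<rho> v") auto
    \<comment> \<open>The larger of the two tuples would bound the lifted value of an Even vertex
      away from \<open>Top\<close>.\<close>
    have "\<exists>q. meas_le (Tup f) (Tup q) \<and> meas_le (Tup h) (Tup q)"
      using meas_le_linear meas_le_refl by blast
    then obtain q where "meas_le (Tup f) (Tup q)" "meas_le (Tup h) (Tup q)" by blast
    then have "meas_le (Lift V E p VE VO ?\<rho> v v) (Tup q)"
      using that VEVO f h by (intro Lift_le[OF vV]) (auto intro!: bexI[of _ w])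
    then show False using top \<rho>n by simp
  qed
  obtain w0 where w0: "w0 \<in> post E v" "Prog V p ?\<rho> v w0 = Top"
    using Lift_mem[OF vV, of ?\<rho>] top \<rho>n nt[OF vV] by auto
  show "odd k" using good(1)[OF w0] .
  show "w \<notin> W \<and> k \<le> p w" if "v \<in> VE" "w \<in> post E v"
    using good(2) PE that by blast
  show "u = v \<or> u \<notin> W \<and> k \<le> p u"
    if "v \<in> VO" and u: "u \<in> post E v" and max: "\<forall>w\<in>post E v. meas_le (\<rho>s n w) (\<rho>s n u)"
  proof (rule disjCI)
    assume bad: "\<not> (u \<notin> W \<and> k \<le> p u)"
    show "u = v"
    proof (rule ccontr)
      assume "u \<noteq> v"
      then have eq: "\<rho>s n u = ?\<rho> u" using \<rho>n by (simp add: Lift_other)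
      have V: "u \<in> V" "w0 \<in> V" using u w0(1) postV by auto
      obtain g where g: "?\<rho> u = Tup g" using nt[OF V(1)] by (cases "?\<rho> u") auto
      obtain h where h: "?\<rho> w0 = Tup h" using nt[OF V(2)] by (cases "?\<rho> w0") auto
      have le: "meas_le (\<rho>s n w0) (Tup g)" using max w0(1) eq g by auto
      \<comment> \<open>Otherwise the maximal value, a tuple, would have to dominate
        \<open>Top\<close>. So both values are those from before the last lift.\<close>
      have "w0 \<noteq> v" using le top by auto
      then have "meas_le (Tup h) (Tup g)" using le h \<rho>n by (simp add: Lift_other)
      moreover have len: "length g = N" "length h = N"
        using bounded_nth(1)[OF b V(1) g] bounded_nth(1)[OF b V(2) h] .
      ultimately have "\<not> lex_lt N ((!) g) ((!) h)" using meas_le_Tup_iff by blast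
      moreover have "Suc k \<le> N" using prio_less[OF vV] v(2) by simp
      ultimately have "\<not> lex_lt (Suc k) ((!) g) ((!) h)" using lex_lt_mono by blast
      moreover have "lex_lt (Suc k) ((!) g) cap"
        using unsaturated[OF b vV v good(1)[OF w0] V(1) _ g] bad by auto
      ultimately have "lex_lt (Suc k) ((!) h) cap" by (rule lex_le_lt_trans)
      then show False using saturated[OF b vV v(2) V(2) w0(2) h] by blast
    qed
  qed
qed

end

subsection \<open>Attractors and the dominion\<close>

context parity_arena
begin

context
  fixes k :: nat and U :: "'v set"
begin

abbreviation stage :: "nat \<Rightarrow> 'v set" where "stage \<equiv> attr_stage V E p VE VO k U"
abbreviation attr :: "'v set" where "attr \<equiv> odd_attr V E p VE VO k U"

lemma stage_mono: "i \<le> j \<Longrightarrow> stage i \<subseteq> stage j"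
  by (rule lift_Suc_mono_le[of stage]) auto

lemma stage_subset_attr: "stage j \<subseteq> attr"
proof (induction j)
  case (Suc j)
  have "u \<in> attr" if "u \<in> stage (Suc j)" for u
  proof -
    from that consider "u \<in> stage j"
      | w where "u \<in> V" "k \<le> p u" "u \<in> VO" "w \<in> post E u" "w \<in> stage j"
      | "u \<in> V" "k \<le> p u" "u \<in> VE" "post E u \<subseteq> stage j" by auto
    then show ?thesis
      by cases (use Suc in \<open>auto intro: odd_attr.odd_step odd_attr.even_step\<close>)
  qed
  then show ?case by blast
qed (auto intro: odd_attr.base)

text \<open>For a vertex of Even the stages of its finitely many successors have a common
  bound.\<close>

lemma attr_in_stage:
  assumes "x \<in> attr"
  shows "\<exists>j. x \<in> stage j"
  using assms
proof (induction rule: odd_attr.induct)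
  case (base u)
  then show ?case by (intro exI[of _ 0]) simp
next
  case (odd_step u w)
  then obtain j where "w \<in> stage j" by blast
  then show ?case using odd_step by (intro exI[of _ "Suc j"]) auto
next
  case (even_step u)
  then obtain f where f: "\<And>w. w \<in> post E u \<Longrightarrow> w \<in> stage (f w)" by metis
  define j where "j = Max (f ` post E u)"
  have "post E u \<subseteq> stage j"
  proof
    fix w assume "w \<in> post E u"
    then have "f w \<le> j" using finite_post by (simp add: j_def)
    then show "w \<in> stage j" using f[OF \<open>w \<in> post E u\<close>] stage_mono by blast
  qed
  then show ?case using even_step by (intro exI[of _ "Suc j"]) auto
qed

lemma attr_new:
  assumes "x \<in> attr" "x \<notin> U"
  shows "\<exists>j. x \<in> stage (Suc j) \<and> x \<notin> stage j"
proof -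
  define i where "i = (LEAST j. x \<in> stage j)"
  have i: "x \<in> stage i" using attr_in_stage[OF assms(1)] unfolding i_def by (rule LeastI_ex)
  moreover have "i \<noteq> 0" using i assms(2) by (metis attr_stage.simps(1))
  then obtain j where "i = Suc j" by (cases i) auto
  moreover have "x \<notin> stage j" using not_less_Least[of j "\<lambda>j. x \<in> stage j"] \<open>i = Suc j\<close> i_def by simp
  ultimately show ?thesis by blast
qed

lemma attr_subset:
  assumes "U \<subseteq> {x\<in>V. k \<le> p x}"
  shows "attr \<subseteq> {x\<in>V. k \<le> p x}"
proof
  fix x assume "x \<in> attr"
  then show "x \<in> {x\<in>V. k \<le> p x}" by (induction rule: odd_attr.induct) (use assms in auto)
qed

text \<open>By monotonicity a vertex enters at one stage only, so a single choice of successor meets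
  the requirement for all \<open>j\<close>.\<close>

lemma ex_attracting_strategy: "\<exists>\<tau>. attracting_strategy V E p VE VO k U \<tau>"
proof -
  define P where "P u j w \<longleftrightarrow> (u \<in> VO \<and> u \<notin> U \<and> u \<in> stage (Suc j) \<and> u \<notin> stage j \<longrightarrow>
      w \<in> post E u \<and> w \<in> stage j)" for u j w
  have "\<exists>w. \<forall>j. P u j w" for u
  proof (cases "\<exists>j. u \<in> VO \<and> u \<notin> U \<and> u \<in> stage (Suc j) \<and> u \<notin> stage j")
    case True
    then obtain j where j: "u \<in> VO" "u \<in> stage (Suc j)" "u \<notin> stage j" by blast
    then obtain w where w: "w \<in> post E u" "w \<in> stage j" using VEVO by auto
    have "i = j" if "u \<in> stage (Suc i)" "u \<notin> stage i" for i
      using j that stage_mono[of "Suc i" j] stage_mono[of "Suc j" i] by (cases i j rule: linorder_cases) auto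
    then have "\<forall>i. P u i w" using w unfolding P_def by blast
    then show ?thesis ..
  next
    case False
    then show ?thesis unfolding P_def by blast
  qed
  then obtain \<tau> where "\<forall>u j. P u j (\<tau> u)" by metis
  then show ?thesis unfolding attracting_strategy_def P_def by blast
qed

end

text \<open>Leaving \<open>V - A\<close> means entering \<open>A\<close>, so the certificate on
  \<open>D\<close> hands a play over to the attracting strategy, which leads to \<open>v\<close>;
  from \<open>v\<close> the play returns to \<open>A \<union> D\<close>.\<close>

lemma dominion_strategy:
  fixes v
  defines "A \<equiv> odd_attr V E p VE VO (p v) {v}"
  assumes v: "v \<in> V" "odd (p v)"
    and \<tau>: "attracting_strategy V E p VE VO (p v) {v} \<tau>"
    and D: "D \<subseteq> {x\<in>V. p v \<le> p x} - A"
    and cert: "odd_cert E p VO D (V - A) \<sigma>'"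
    and succO: "v \<in> VO \<Longrightarrow> u \<in> post E v \<and> u \<in> A \<union> D"
    and succE: "v \<in> VE \<Longrightarrow> post E v \<subseteq> A \<union> D"
  shows "\<exists>\<sigma>. odd_strategy E VO \<sigma> \<and> strategy_wins E p VO \<sigma> (A \<union> D) \<and>
    strategy_closed E VO \<sigma> (A \<union> D) \<and> (v \<in> VO \<longrightarrow> \<sigma> v = u) \<and> (\<forall>x\<in>(A - {v}) \<inter> VO. \<sigma> x = \<tau> x)"
proof -
  define S where "S j = attr_stage V E p VE VO (p v) {v} j" for j
  \<comment> \<open>The last case only makes \<open>\<sigma>\<close> a legal strategy outside
    \<open>A \<union> D\<close>.\<close>
  define \<sigma> where "\<sigma> x = (if x = v then u else if x \<in> A then \<tau> x else if x \<in> D then \<sigma>' x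
      else SOME w. w \<in> post E x)" for x
  have SA: "S j \<subseteq> A" for j unfolding S_def A_def by (rule stage_subset_attr)
  have vA: "v \<in> A" unfolding A_def by (rule odd_attr.base) simp
  have A: "A \<subseteq> {x\<in>V. p v \<le> p x}" unfolding A_def by (rule attr_subset) (use v in simp)
  have new: "\<exists>j. x \<in> S (Suc j) \<and> x \<notin> S j" if "x \<in> A" "x \<noteq> v" for x
    using attr_new[of x "p v" "{v}"] that unfolding A_def S_def by simp
  have \<tau>S: "\<tau> x \<in> post E x \<and> \<tau> x \<in> S j" if "x \<in> VO" "x \<noteq> v" "x \<in> S (Suc j)" "x \<notin> S j" for x j
    using \<tau> that unfolding attracting_strategy_def S_def by blast
  have evenS: "post E x \<subseteq> S j" if "x \<notin> VO" "x \<in> S (Suc j)" "x \<notin> S j" for x j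
    using that unfolding S_def by simp
  have \<sigma>post: "\<sigma> x \<in> post E x" if "x \<in> VO" for x
  proof -
    have "x \<in> V" using that VEVO by auto
    then have "(SOME w. w \<in> post E x) \<in> post E x" using post_nonempty by (simp add: some_in_eq)
    moreover have "\<tau> x \<in> post E x" if "x \<in> A" "x \<noteq> v" using new[OF that] \<tau>S \<open>x \<in> VO\<close> that by blast
    moreover have "\<sigma>' x \<in> post E x" if "x \<in> D" using cert \<open>x \<in> VO\<close> that unfolding odd_cert_def by auto
    ultimately show ?thesis using succO that unfolding \<sigma>_def by auto
  qed
  have stepA: "y \<in> S j" if "x \<noteq> v" "x \<in> S (Suc j)" "x \<notin> S j" "y \<in> post E x" "x \<in> VO \<longrightarrow> y = \<sigma> x"
    for x y j
  proof (cases "x \<in> VO")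
    case True
    have "x \<in> A" using SA that(2) by blast
    then show ?thesis using \<tau>S[OF True that(1-3)] that(1,5) True by (simp add: \<sigma>_def)
  qed (use evenS that in blast)
  have step: "y \<in> A \<union> D" if x: "x \<in> A \<union> D" and y: "y \<in> post E x" "x \<in> VO \<longrightarrow> y = \<sigma> x" for x y
  proof -
    have yV: "y \<in> V" using y(1) postV by blast
    consider "x = v" | "x \<in> A" "x \<noteq> v" | "x \<notin> A" "x \<in> D" using x by blast
    then show ?thesis
    proof cases
      case 1
      then show ?thesis
        using succO succE y v(1) VEVO by (cases "v \<in> VO") (auto simp: \<sigma>_def)
    next
      case 2
      then obtain j where "x \<in> S (Suc j)" "x \<notin> S j" using new by blast
      from stepA[OF 2(2) this y] show ?thesis using SA by blast
    next
      case 3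
      then have *: "if x \<in> VO then \<sigma>' x \<in> post E x \<and> (\<sigma>' x \<in> D \<or> \<sigma>' x \<notin> V - A)
          else post E x \<inter> (V - A) \<subseteq> D"
        using cert unfolding odd_cert_def by blast
      have "\<sigma> x = \<sigma>' x" using 3 vA by (auto simp: \<sigma>_def)
      then show ?thesis using * y yV by (cases "x \<in> VO") auto
    qed
  qed
  have closed: "\<pi> i \<in> A \<union> D" if "is_play E \<pi>" "consistent VO \<sigma> \<pi>" "\<pi> 0 \<in> A \<union> D" for \<pi> i
  proof (induction i)
    case (Suc i)
    then show ?case
      using play_post[OF that(1), of i] that(2) by (intro step[OF Suc]) (auto simp: consistent_def)
  qed (fact that(3))
  \<comment> \<open>Until \<open>v\<close> is met, every move lowers the stage, and stage 0 is
    \<open>{v}\<close>.\<close>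
  have reach: "\<exists>i'\<ge>i. \<pi> i' = v" if "is_play E \<pi>" "consistent VO \<sigma> \<pi>" "\<pi> i \<in> S j" for \<pi> i j
    using that(3)
  proof (induction j arbitrary: i)
    case 0
    then show ?case by (auto simp: S_def)
  next
    case (Suc j)
    show ?case
    proof (cases "\<pi> i = v \<or> \<pi> i \<in> S j")
      case True
      then show ?thesis
      proof
        assume "\<pi> i = v"
        then show ?thesis by (intro exI[of _ i]) simp
      qed (rule Suc.IH)
    next
      case False
      have "\<pi> (Suc i) \<in> S j"
        by (rule stepA[of "\<pi> i" j "\<pi> (Suc i)"])
          (use False Suc.prems play_post[OF that(1), of i] that(2) in \<open>auto simp: consistent_def\<close>)
      from Suc.IH[OF this] obtain i' where "Suc i \<le> i'" "\<pi> i' = v" by blast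
      then show ?thesis by (intro exI[of _ i']) simp
    qed
  qed
  have wins: "odd_wins p \<pi>" if pl: "is_play E \<pi>" and con: "consistent VO \<sigma> \<pi>" and 0: "\<pi> 0 \<in> A \<union> D" for \<pi>
  proof (cases "\<exists>\<^sub>\<infinity>i. \<pi> i = v")
    case True
    then have "\<exists>\<^sub>\<infinity>i. p (\<pi> i) = p v" by (rule frequently_elim1) simp
    moreover have "p v \<le> p (\<pi> i)" for i using closed[OF that, of i] A D by blast
    ultimately show ?thesis using odd_wins_least v(2) by blast
  next
    case False
    then obtain n where n: "\<And>i. n \<le> i \<Longrightarrow> \<pi> i \<noteq> v"
      by (auto simp: not_frequently cofinite_eq_sequentially eventually_sequentially)
    \<comment> \<open>After the last visit to \<open>v\<close> the play cannot be in
      \<open>A\<close>, since \<open>reach\<close> would force one more visit.\<close>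
    have "\<pi> i \<notin> A" if i: "n \<le> i" for i
    proof
      assume "\<pi> i \<in> A"
      then obtain j where "\<pi> i \<in> S (Suc j)" using new[OF _ n[OF i]] by blast
      from reach[OF pl con this] obtain i' where "i \<le> i'" "\<pi> i' = v" by blast
      with n[of i'] i show False by simp
    qed
    then have inD: "\<pi> (i + n) \<in> D" "\<pi> (i + n) \<notin> A" for i
      using closed[OF pl con 0, of "i + n"] by auto
    have "consistent VO \<sigma>' (\<lambda>i. \<pi> (i + n))"
      by (rule consistent_cong[OF consistent_shift[OF con]]) (simp add: \<sigma>_def n inD)
    then have "odd_wins p (\<lambda>i. \<pi> (i + n))"
      using cert is_play_shift[OF pl] inD unfolding odd_cert_def by blast
    then show ?thesis by (simp only: odd_wins_shift)
  qed
  have "odd_strategy E VO \<sigma>" using \<sigma>post by (simp add: odd_strategy_def post_def)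
  moreover have "strategy_wins E p VO \<sigma> (A \<union> D)" using wins unfolding strategy_wins_def by blast
  moreover have "strategy_closed E VO \<sigma> (A \<union> D)" using closed unfolding strategy_closed_def by blast
  moreover have "\<sigma> v = u" "\<forall>x\<in>(A - {v}) \<inter> VO. \<sigma> x = \<tau> x" by (simp_all add: \<sigma>_def)
  ultimately show ?thesis by blast
qed

end

section \<open>Assembling the dominion\<close>

theorem theorem4:
  fixes V :: "'v set" and E :: "('v \<times> 'v) set" and p :: "'v \<Rightarrow> nat"
    and VE VO :: "'v set"
    and \<rho>s :: "nat \<Rightarrow> 'v \<Rightarrow> meas" and vs :: "nat \<Rightarrow> 'v" and n :: nat and v :: 'v
  assumes game: "parity_game V E p VE VO"
    and lift: "lifting_sequence V E p VE VO \<rho>s vs n"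
    and vV: "v \<in> V"
    and top: "\<rho>s n v = Top"
    and first: "\<forall>j < n. \<forall>w \<in> V. \<rho>s j w \<noteq> Top"
  shows
    "(v \<in> VO \<longrightarrow>
       (\<forall>u \<in> post E v. (\<forall>w \<in> post E v. meas_le (\<rho>s n w) (\<rho>s n u)) \<longrightarrow>
          (\<exists>D. odd_dominion V E p VO D \<and>
               odd_attr V E p VE VO (p v) {v} \<subseteq> D \<and> (\<forall>w \<in> D. p w \<ge> p v) \<and>
               (\<forall>\<tau>. attracting_strategy V E p VE VO (p v) {v} \<tau> \<longrightarrow>
                  (\<exists>\<sigma>. odd_strategy E VO \<sigma> \<and> strategy_wins E p VO \<sigma> D \<and>
                       strategy_closed E VO \<sigma> D \<and> \<sigma> v = u \<and>
                       (\<forall>x \<in> (odd_attr V E p VE VO (p v) {v} - {v}) \<inter> VO. \<sigma> x = \<tau> x))))))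
     \<and>
     (v \<in> VE \<longrightarrow>
       (\<exists>D. odd_dominion V E p VO D \<and>
            odd_attr V E p VE VO (p v) {v} \<subseteq> D \<and> (\<forall>w \<in> D. p w \<ge> p v) \<and>
            post E v \<subseteq> D \<and>
            (\<forall>\<tau>. attracting_strategy V E p VE VO (p v) {v} \<tau> \<longrightarrow>
               (\<exists>\<sigma>. odd_strategy E VO \<sigma> \<and> strategy_wins E p VO \<sigma> D \<and>
                    strategy_closed E VO \<sigma> D \<and>
                    (\<forall>x \<in> (odd_attr V E p VE VO (p v) {v} - {v}) \<inter> VO. \<sigma> x = \<tau> x)))))"
proof -
  interpret parity_arena V E p VE VO by unfold_locales (rule game)
  define A where "A = odd_attr V E p VE VO (p v) {v}"
  \<comment> \<open>The attractor is left out of the arena and of the target, so that escaping from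
    both is the same as reaching \<open>A\<close>.\<close>
  define X where "X = {x\<in>V. p v \<le> p x} - A"
  have A: "A \<subseteq> {x\<in>V. p v \<le> p x}" unfolding A_def by (rule attr_subset) (use vV in simp)
  have vA: "v \<in> A" unfolding A_def by (rule odd_attr.base) simp
  have "finite X" "X \<inter> {x\<in>V. p x < p v} = {}" using finV by (auto simp: X_def)
  from determinacy[OF this, of E p VO] obtain W D' r \<sigma>' where *: "W \<union> D' = X" "W \<inter> D' = {}"
    "even_cert E p VO W {x\<in>V. p x < p v} r" "odd_cert E p VO D' (X \<union> {x\<in>V. p x < p v}) \<sigma>'"
    by blast
  have "X \<union> {x\<in>V. p x < p v} = V - A" using A by (auto simp: X_def)
  note oc = *(4)[unfolded this]
  interpret even_cert_arena V E p VE VO "p v" W r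
    by unfold_locales (use * in \<open>auto simp: X_def\<close>)
  have vW: "v \<notin> W" using *(1) vA by (auto simp: X_def)
  note ts = top_successors[OF lift vV top first vW refl]
  \<comment> \<open>A successor equal to \<open>v\<close>, possible through a self-loop, is covered
    by \<open>v \<in> A\<close>.\<close>
  have inD: "w \<in> A \<union> D'" if "w \<in> post E v" "w = v \<or> w \<notin> W \<and> p v \<le> p w" for w
    using that vA postV *(1) by (auto simp: X_def)
  have D'X: "D' \<subseteq> {x\<in>V. p v \<le> p x} - A" using *(1) by (auto simp: X_def)
  let ?D = "A \<union> D'"
  have DV: "?D \<subseteq> V" "\<forall>w\<in>?D. p v \<le> p w" using A D'X by auto
  obtain \<tau>0 where \<tau>0: "attracting_strategy V E p VE VO (p v) {v} \<tau>0"
    using ex_attracting_strategy by blast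
  \<comment> \<open>For \<open>v \<in> VE\<close> the premise on \<open>u\<close> is vacuous, so one
    statement serves both parts.\<close>
  have strat: "\<exists>\<sigma>. odd_strategy E VO \<sigma> \<and> strategy_wins E p VO \<sigma> ?D \<and> strategy_closed E VO \<sigma> ?D \<and>
      (v \<in> VO \<longrightarrow> \<sigma> v = u) \<and> (\<forall>x\<in>(A - {v}) \<inter> VO. \<sigma> x = \<tau> x)"
    if "attracting_strategy V E p VE VO (p v) {v} \<tau>"
      "v \<in> VO \<Longrightarrow> u \<in> post E v \<and> (\<forall>w\<in>post E v. meas_le (\<rho>s n w) (\<rho>s n u))" for u \<tau>
    by (rule dominion_strategy[OF vV ts(1) that(1), folded A_def, OF D'X oc])
      (use that(2) ts(2,3) inD in blast)+
  \<comment> \<open>Being a dominion needs just one strategy, here the one built from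
    \<open>\<tau>0\<close>; the set \<open>A \<union> D'\<close> is the same for every
    \<open>u\<close> and \<open>\<tau>\<close>.\<close>
  have dom: "odd_dominion V E p VO ?D"
    if "v \<in> VO \<Longrightarrow> u \<in> post E v \<and> (\<forall>w\<in>post E v. meas_le (\<rho>s n w) (\<rho>s n u))" for u
    using strat[OF \<tau>0 that] DV(1) unfolding odd_dominion_def by blast
  show ?thesis
    unfolding A_def[symmetric]
  proof (intro conjI impI ballI)
    fix u assume vO: "v \<in> VO" and u: "u \<in> post E v" "\<forall>w\<in>post E v. meas_le (\<rho>s n w) (\<rho>s n u)"
    show "\<exists>D. odd_dominion V E p VO D \<and> A \<subseteq> D \<and> (\<forall>w\<in>D. p v \<le> p w) \<and>
        (\<forall>\<tau>. attracting_strategy V E p VE VO (p v) {v} \<tau> \<longrightarrow>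
          (\<exists>\<sigma>. odd_strategy E VO \<sigma> \<and> strategy_wins E p VO \<sigma> D \<and> strategy_closed E VO \<sigma> D \<and>
            \<sigma> v = u \<and> (\<forall>x\<in>(A - {v}) \<inter> VO. \<sigma> x = \<tau> x)))"
    proof (intro exI[of _ ?D] conjI allI impI)
      show "odd_dominion V E p VO ?D" by (rule dom) (use u in blast)
      fix \<tau> assume "attracting_strategy V E p VE VO (p v) {v} \<tau>"
      from strat[OF this, of u] show "\<exists>\<sigma>. odd_strategy E VO \<sigma> \<and> strategy_wins E p VO \<sigma> ?D \<and>
          strategy_closed E VO \<sigma> ?D \<and> \<sigma> v = u \<and> (\<forall>x\<in>(A - {v}) \<inter> VO. \<sigma> x = \<tau> x)"
        using u vO by blast
    qed (use DV in auto)
  next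
    assume vE: "v \<in> VE"
    then have nO: "v \<notin> VO" using VEVO by blast
    show "\<exists>D. odd_dominion V E p VO D \<and> A \<subseteq> D \<and> (\<forall>w\<in>D. p v \<le> p w) \<and> post E v \<subseteq> D \<and>
        (\<forall>\<tau>. attracting_strategy V E p VE VO (p v) {v} \<tau> \<longrightarrow>
          (\<exists>\<sigma>. odd_strategy E VO \<sigma> \<and> strategy_wins E p VO \<sigma> D \<and> strategy_closed E VO \<sigma> D \<and>
            (\<forall>x\<in>(A - {v}) \<inter> VO. \<sigma> x = \<tau> x)))"
    proof (intro exI[of _ ?D] conjI allI impI)
      show "odd_dominion V E p VO ?D" by (rule dom) (use nO in blast)
      show "post E v \<subseteq> ?D" using inD ts(2)[OF vE] by blast
      fix \<tau> assume "attracting_strategy V E p VE VO (p v) {v} \<tau>"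
      from strat[OF this] show "\<exists>\<sigma>. odd_strategy E VO \<sigma> \<and> strategy_wins E p VO \<sigma> ?D \<and>
          strategy_closed E VO \<sigma> ?D \<and> (\<forall>x\<in>(A - {v}) \<inter> VO. \<sigma> x = \<tau> x)"
        using nO by blast
    qed (use DV in auto)
  qed
qed

end
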